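(* In the setting described in the context, with POD space $X=H_0^1(\Omega)$, there is a constant $C>0$, not depending on any discretization parameter (i.e. not on $V^h$, $N$, $\Delta t$ or $r$), such that the errors $e^k=u^k-u_r^k$, $k=1,\dots,N$, between the backward Euler finite element solution and the BE-POD-ROM solution satisfy $$\max_{1\le k\le N}\|e^k\|_{L^2}^2\le C\left(\sum_{i=r+1}^s\lambda_i^{DQ1}\|\varphi_i\|_{L^2}^2+\|\phi_r^1\|_{L^2}^2\right),$$ $$\max_{1\le k\le N}\|\nabla e^k\|_{L^2}^2\le C\left(\sum_{i=r+1}^s\lambda_i^{DQ1}\big(\|\varphi_i\|_{L^2}^2+1\big)+\|\phi_r^1\|_{H_0^1}^2\right),$$ and $$\|e^N\|_{L^2}^2+\nu\Delta t\sum_{n=1}^{N-1}\|\nabla e^{n+1}\|_{L^2}^2\le C\left(\sum_{i=r+1}^s\lambda_i^{DQ1}\big(1+\|\varphi_i\|_{L^2}^2\big)+\|\phi_r^1\|_{L^2}^2\right).$$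
   Context: All function spaces are real. $\Omega\subset\mathbb{R}^d$ ($d\ge1$) is an open bounded domain with Lipschitz continuous boundary, $V=H_0^1(\Omega)$ with inner product $(g,h)_{H_0^1}=(\nabla g,\nabla h)_{L^2}$, $\nu>0$ is a constant, $T>0$ is fixed, $N\ge2$, $\Delta t=T/(N-1)$, $t_n=(n-1)\Delta t$, and $f$ is a given forcing function, with $f^n=f(t_n)$. $V^h\subset V$ is a standard conforming (finite-dimensional) finite element space. Backward Euler finite element solution: $\{u^n\}_{n=1}^N\subset V^h$, with $u^1$ the given initial condition and, for $n=1,\dots,N-1$, $$\Big(\tfrac{u^{n+1}-u^n}{\Delta t},v\Big)_{L^2}+\nu(\nabla u^{n+1},\nabla v)_{L^2}=(f^{n+1},v)_{L^2}\quad\forall v\in V^h.$$ POD modes: write $\partial z^n=(z^{n+1}-z^n)/\Delta t$. Let $S=\mathbb{R}^N$ with inner product $(g,h)_S=g^1h^1+\Delta t\sum_{j=2}^Ng^jh^j$, and $K_1:S\to X$, $K_1f=f^1u^1+\sum_{j=1}^{N-1}\Delta t f^{j+1}\partial u^j$. Its singular value decomposition has singular values $(\lambda_i^{DQ1})^{1/2}$ (nonincreasing) and orthonormal singular vectors $f_i\in S$, $\varphi_i\in X$, with $K_1f_i=(\lambda_i^{DQ1})^{1/2}\varphi_i$. The $\varphi_i$ are the POD modes, the $\lambda_i^{DQ1}$ the POD eigenvalues, and $s$ is the number of positive POD eigenvalues. $r$ is a positive integer with $\varphi_1,\dots,\varphi_r\in V^h$, and $V_r^h=\mathrm{span}\{\varphi_j\}_{j=1}^r\subset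 V^h$. $\Pi_r^X:X\to X$ is the orthogonal projection onto $V_r^h$. BE-POD-ROM: $\{u_r^n\}_{n=1}^N\subset V_r^h$ with $u_r^1=\Pi_r^Xu^1$ and, for $n=1,\dots,N-1$, $$\Big(\tfrac{u_r^{n+1}-u_r^n}{\Delta t},v_r\Big)_{L^2}+\nu(\nabla u_r^{n+1},\nabla v_r)_{L^2}=(f^{n+1},v_r)_{L^2}\quad\forall v_r\in V_r^h.$$ The Ritz projection $R_r:V\to V_r^h$ is defined by $(\nabla(w-R_rw),\nabla v_r)_{L^2}=0$ for all $v_r\in V_r^h$. Finally $\phi_r^n=u_r^n-R_ru^n$ (distinct from the POD modes $\varphi_i$). *)

theory Defs
  imports "HOL-Analysis.Analysis"
begin

text \<open>
  Elements of Lebesgue and Sobolev spaces on a set \<open>\<Omega>\<close> are represented by functions on the whole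
  Euclidean space; only their restriction to \<open>\<Omega>\<close>, up to null sets, matters.  Where an identity between
  elements of such a space is meant it is stated almost everywhere on \<open>\<Omega>\<close>.
\<close>

section \<open>Lipschitz domains\<close>

text \<open>
  Locally, after choosing a unit vector \<open>e\<close> as the vertical direction, the set is the strict
  epigraph of a Lipschitz function of the component orthogonal to \<open>e\<close>.  In dimension one the
  orthogonal complement is trivial and the function is a constant.
\<close>

definition lipschitz_boundary :: "'a::euclidean_space set \<Rightarrow> bool" where
  "lipschitz_boundary \<Omega> \<longleftrightarrow>
     (\<forall>x\<in>frontier \<Omega>. \<exists>e \<gamma> L \<rho>. norm e = 1 \<and> \<rho> > 0 \<and>
        L-lipschitz_on {y. y \<bullet> e = 0} (\<gamma> :: 'a \<Rightarrow> real) \<and>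
        \<Omega> \<inter> ball x \<rho> = {y \<in> ball x \<rho>. y \<bullet> e > \<gamma> (y - (y \<bullet> e) *\<^sub>R e)})"

definition bounded_lipschitz_domain :: "'a::euclidean_space set \<Rightarrow> bool" where
  "bounded_lipschitz_domain \<Omega> \<longleftrightarrow>
     \<Omega> \<noteq> {} \<and> open \<Omega> \<and> connected \<Omega> \<and> bounded \<Omega> \<and> lipschitz_boundary \<Omega>"

section \<open>The spaces \<open>L\<^sup>2\<close>, \<open>H\<^sup>1\<close> and \<open>H\<^sup>1\<^sub>0\<close>\<close>

text \<open>The codomain is either \<open>real\<close> or, for gradients, the ambient Euclidean space.\<close>

definition L2_space :: "'a::euclidean_space set \<Rightarrow> ('a \<Rightarrow> 'b::euclidean_space) set" where
  "L2_space \<Omega> = {g. g \<in> borel_measurable (lebesgue_on \<Omega>) \<and>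
                     integrable (lebesgue_on \<Omega>) (\<lambda>x. (norm (g x))\<^sup>2)}"

definition L2_inner :: "'a::euclidean_space set \<Rightarrow> ('a \<Rightarrow> 'b::euclidean_space) \<Rightarrow> ('a \<Rightarrow> 'b) \<Rightarrow> real" where
  "L2_inner \<Omega> g h = (\<integral>x. g x \<bullet> h x \<partial>(lebesgue_on \<Omega>))"

definition L2_norm :: "'a::euclidean_space set \<Rightarrow> ('a \<Rightarrow> 'b::euclidean_space) \<Rightarrow> real" where
  "L2_norm \<Omega> g = sqrt (L2_inner \<Omega> g g)"

primrec C_k :: "nat \<Rightarrow> ('a::euclidean_space \<Rightarrow> real) \<Rightarrow> bool" where
  "C_k 0 g \<longleftrightarrow> continuous_on UNIV g"
| "C_k (Suc k) g \<longleftrightarrow> (\<forall>x. g differentiable (at x)) \<and>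
                     (\<forall>v. C_k k (\<lambda>x. frechet_derivative g (at x) v))"

text \<open>The space \<open>C\<^sub>c\<^sup>\<infinity>(\<Omega>)\<close>, its members being extended by zero.\<close>

definition test_functions :: "'a::euclidean_space set \<Rightarrow> ('a \<Rightarrow> real) set" where
  "test_functions \<Omega> = {\<psi>. (\<forall>k. C_k k \<psi>) \<and>
      compact (closure {x. \<psi> x \<noteq> 0}) \<and> closure {x. \<psi> x \<noteq> 0} \<subseteq> \<Omega>}"

definition is_weak_grad :: "'a::euclidean_space set \<Rightarrow> ('a \<Rightarrow> real) \<Rightarrow> ('a \<Rightarrow> 'a) \<Rightarrow> bool" where
  "is_weak_grad \<Omega> w g \<longleftrightarrow> g \<in> L2_space \<Omega> \<and>
     (\<forall>\<psi>\<in>test_functions \<Omega>. \<forall>b\<in>Basis.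
        (\<integral>x. w x * frechet_derivative \<psi> (at x) b \<partial>(lebesgue_on \<Omega>))
          = - (\<integral>x. (g x \<bullet> b) * \<psi> x \<partial>(lebesgue_on \<Omega>)))"

text \<open>For \<open>w\<close> in \<open>H\<^sup>1(\<Omega>)\<close> the weak gradient is determined up to null sets, so that
  the choice below does not affect any integral.\<close>

definition weak_grad :: "'a::euclidean_space set \<Rightarrow> ('a \<Rightarrow> real) \<Rightarrow> 'a \<Rightarrow> 'a" where
  "weak_grad \<Omega> w = (SOME g. is_weak_grad \<Omega> w g)"

definition H1_space :: "'a::euclidean_space set \<Rightarrow> ('a \<Rightarrow> real) set" where
  "H1_space \<Omega> = {w. w \<in> L2_space \<Omega> \<and> (\<exists>g. is_weak_grad \<Omega> w g)}"

definition H1_norm :: "'a::euclidean_space set \<Rightarrow> ('a \<Rightarrow> real) \<Rightarrow> real" where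
  "H1_norm \<Omega> w = sqrt ((L2_norm \<Omega> w)\<^sup>2 + (L2_norm \<Omega> (weak_grad \<Omega> w))\<^sup>2)"

definition H10_space :: "'a::euclidean_space set \<Rightarrow> ('a \<Rightarrow> real) set" where
  "H10_space \<Omega> = {w \<in> H1_space \<Omega>. \<exists>\<psi>. (\<forall>k. \<psi> k \<in> test_functions \<Omega>) \<and>
       (\<lambda>k::nat. H1_norm \<Omega> (\<lambda>x. w x - \<psi> k x)) \<longlonglongrightarrow> 0}"

definition H10_inner :: "'a::euclidean_space set \<Rightarrow> ('a \<Rightarrow> real) \<Rightarrow> ('a \<Rightarrow> real) \<Rightarrow> real" where
  "H10_inner \<Omega> g h = L2_inner \<Omega> (weak_grad \<Omega> g) (weak_grad \<Omega> h)"

definition H10_norm :: "'a::euclidean_space set \<Rightarrow> ('a \<Rightarrow> real) \<Rightarrow> real" where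
  "H10_norm \<Omega> w = sqrt (H10_inner \<Omega> w w)"

section \<open>Subspaces and projections\<close>

definition conforming_space :: "'a::euclidean_space set \<Rightarrow> ('a \<Rightarrow> real) set \<Rightarrow> bool" where
  "conforming_space \<Omega> Vh \<longleftrightarrow>
     (\<exists>B. finite B \<and> B \<subseteq> H10_space \<Omega> \<and> Vh = {\<lambda>x. \<Sum>b\<in>B. c b * b x |c. True})"

definition pod_space :: "(nat \<Rightarrow> 'a \<Rightarrow> real) \<Rightarrow> nat \<Rightarrow> ('a \<Rightarrow> real) set" where
  "pod_space \<phi> r = {\<lambda>x. \<Sum>j=1..r. c j * \<phi> j x |c. True}"

definition is_orth_proj ::
  "(('a \<Rightarrow> real) \<Rightarrow> ('a \<Rightarrow> real) \<Rightarrow> real) \<Rightarrow> ('a \<Rightarrow> real) set \<Rightarrow> ('a \<Rightarrow> real) set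
     \<Rightarrow> (('a \<Rightarrow> real) \<Rightarrow> 'a \<Rightarrow> real) \<Rightarrow> bool" where
  "is_orth_proj ip X W P \<longleftrightarrow>
     (\<forall>w\<in>X. P w \<in> W \<and> (\<forall>v\<in>W. ip (\<lambda>x. w x - P w x) v = 0))"

definition is_ritz_proj ::
  "'a::euclidean_space set \<Rightarrow> ('a \<Rightarrow> real) set \<Rightarrow> (('a \<Rightarrow> real) \<Rightarrow> 'a \<Rightarrow> real) \<Rightarrow> bool" where
  "is_ritz_proj \<Omega> W R \<longleftrightarrow>
     (\<forall>w\<in>H10_space \<Omega>. R w \<in> W \<and>
        (\<forall>v\<in>W. L2_inner \<Omega> (weak_grad \<Omega> (\<lambda>x. w x - R w x)) (weak_grad \<Omega> v) = 0))"

section \<open>Backward Euler scheme\<close>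

definition time_step :: "real \<Rightarrow> nat \<Rightarrow> real" where
  "time_step T N = T / (real N - 1)"

definition time_node :: "real \<Rightarrow> nat \<Rightarrow> nat \<Rightarrow> real" where
  "time_node T N n = (real n - 1) * time_step T N"

text \<open>Used with the finite element space and with the POD space as trial and test space \<open>W\<close>.
  The initial condition \<open>u 1\<close> is left free, and the values \<open>u n\<close> matter for \<open>1 \<le> n \<le> N\<close> only.\<close>

definition backward_euler ::
  "'a::euclidean_space set \<Rightarrow> real \<Rightarrow> real \<Rightarrow> (real \<Rightarrow> 'a \<Rightarrow> real) \<Rightarrow> nat
     \<Rightarrow> ('a \<Rightarrow> real) set \<Rightarrow> (nat \<Rightarrow> 'a \<Rightarrow> real) \<Rightarrow> bool" where
  "backward_euler \<Omega> \<nu> T f N W u \<longleftrightarrow>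
     (\<forall>n\<in>{1..N}. u n \<in> W) \<and>
     (\<forall>n\<in>{1..N-1}. \<forall>v\<in>W.
        L2_inner \<Omega> (\<lambda>x. (u (n+1) x - u n x) / time_step T N) v
          + \<nu> * L2_inner \<Omega> (weak_grad \<Omega> (u (n+1))) (weak_grad \<Omega> v)
        = L2_inner \<Omega> (f (time_node T N (n+1))) v)"

section \<open>POD with difference quotients\<close>

definition diff_quot :: "real \<Rightarrow> (nat \<Rightarrow> 'a \<Rightarrow> real) \<Rightarrow> nat \<Rightarrow> 'a \<Rightarrow> real" where
  "diff_quot dt z n = (\<lambda>x. (z (n+1) x - z n x) / dt)"

text \<open>Vectors of \<open>S = \<real>\<^sup>N\<close> are functions on the naturals of which only the values at \<open>1..N\<close> matter.\<close>

definition S_inner :: "real \<Rightarrow> nat \<Rightarrow> (nat \<Rightarrow> real) \<Rightarrow> (nat \<Rightarrow> real) \<Rightarrow> real" where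
  "S_inner dt N g h = g 1 * h 1 + dt * (\<Sum>j=2..N. g j * h j)"

definition K1 :: "real \<Rightarrow> nat \<Rightarrow> (nat \<Rightarrow> 'a \<Rightarrow> real) \<Rightarrow> (nat \<Rightarrow> real) \<Rightarrow> 'a \<Rightarrow> real" where
  "K1 dt N u g = (\<lambda>x. g 1 * u 1 x + (\<Sum>j=1..N-1. dt * g (j+1) * diff_quot dt u j x))"

definition orthonormal_on :: "('b \<Rightarrow> 'b \<Rightarrow> real) \<Rightarrow> nat set \<Rightarrow> (nat \<Rightarrow> 'b) \<Rightarrow> bool" where
  "orthonormal_on ip I v \<longleftrightarrow> (\<forall>i\<in>I. \<forall>j\<in>I. ip (v i) (v j) = (if i = j then 1 else 0))"

text \<open>
  Singular value decomposition of \<open>K1 dt N u\<close> from \<open>S\<close> to \<open>H\<^sup>1\<^sub>0(\<Omega>)\<close>, with squared singular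
  values \<open>lam i\<close>.  The \<open>N\<close> orthonormal right singular vectors \<open>\<xi> i\<close> form a basis of \<open>S\<close>.  The left ones are
  given for all \<open>i \<ge> 1\<close>, since the number of POD modes need not be bounded by \<open>N\<close>.
\<close>

definition is_pod_svd ::
  "'a::euclidean_space set \<Rightarrow> real \<Rightarrow> nat \<Rightarrow> (nat \<Rightarrow> 'a \<Rightarrow> real)
     \<Rightarrow> (nat \<Rightarrow> real) \<Rightarrow> (nat \<Rightarrow> nat \<Rightarrow> real) \<Rightarrow> (nat \<Rightarrow> 'a \<Rightarrow> real) \<Rightarrow> bool" where
  "is_pod_svd \<Omega> dt N u lam \<xi> \<phi> \<longleftrightarrow>
     (\<forall>i\<in>{1..N}. 0 \<le> lam i) \<and>
     (\<forall>i\<in>{1..N}. \<forall>j\<in>{1..N}. i \<le> j \<longrightarrow> lam j \<le> lam i) \<and>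
     orthonormal_on (S_inner dt N) {1..N} \<xi> \<and>
     (\<forall>i\<ge>1. \<phi> i \<in> H10_space \<Omega>) \<and>
     orthonormal_on (H10_inner \<Omega>) {1..} \<phi> \<and>
     (\<forall>i\<in>{1..N}. AE x in lebesgue_on \<Omega>. K1 dt N u (\<xi> i) x = sqrt (lam i) * \<phi> i x)"

definition num_pos_eigenvalues :: "nat \<Rightarrow> (nat \<Rightarrow> real) \<Rightarrow> nat" where
  "num_pos_eigenvalues N lam = card {i\<in>{1..N}. lam i > 0}"

end

theory Submission
  imports Defs
begin

text \<open>
  The error splits as \<open>e = \<eta> - p\<close> with the Ritz projection error \<open>\<eta>\<^sup>n = u\<^sup>n - R u\<^sup>n\<close> and the
  discrete remainder \<open>p\<^sup>n = u\<^sub>r\<^sup>n - R u\<^sup>n\<close>, which lies in the POD space (it is \<open>\<phi>\<^sub>r\<close> in the theorem).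

  \<^emph>\<open>The projection error.\<close>  In the \<open>H\<^sup>1\<^sub>0\<close> inner product the Ritz projection onto the span of the
  orthonormal modes is the truncated Fourier expansion, so it annihilates the discarded modes.  The
  right singular vectors form a complete system of \<open>S\<close> (\<open>orthonormal_completeness\<close>), hence the
  snapshots \<open>u\<^sup>1, \<partial>u\<^sup>1, \<dots>, \<partial>u\<^sup>N\<^sup>-\<^sup>1\<close> can be recovered from the vectors \<open>K\<^sub>1 \<xi>\<^sub>i\<close>, and their residuals
  are combinations of the discarded modes only.  Orthonormality of the \<open>\<xi>\<^sub>i\<close> turns the weighted sum of
  squares of these residuals into \<open>\<Sum>\<^sub>i\<^sub>>\<^sub>r \<lambda>\<^sub>i \<parallel>\<phi>\<^sub>i\<parallel>\<^sup>2\<close>, in the \<open>L\<^sup>2\<close> norm and in the \<open>H\<^sup>1\<^sub>0\<close> norm alike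
  (\<open>pod_projection_error\<close>).  Since the data contain the initial value together with all difference
  quotients, summing in time controls \<open>\<eta>\<^sup>k\<close> for every single \<open>k\<close>, with no factor that depends on \<open>N\<close>
  (\<open>pointwise_in_time_bound\<close>).

  \<^emph>\<open>The discrete remainder.\<close>  Subtracting the two schemes, and using the Ritz orthogonality to remove
  \<open>\<nabla>\<eta>\<close>, shows that \<open>p\<close> solves the backward Euler scheme in the POD space with right-hand side
  \<open>\<partial>\<eta>\<close> (\<open>pod_error_equation\<close>).  Testing with \<open>p\<^sup>n\<^sup>+\<^sup>1\<close> bounds the \<open>L\<^sup>2\<close> norm and the dissipation, and
  testing with the increment of \<open>p\<close> bounds the gradient, in terms of \<open>p\<^sup>1\<close> and
  \<open>\<Delta>t \<Sum> \<parallel>\<partial>\<eta>\<^sup>n\<parallel>\<^sup>2\<close> (locale \<open>discrete_parabolic\<close>).  The first rests on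
  \<open>\<parallel>p\<^sup>n\<^sup>+\<^sup>1\<parallel> \<le> \<parallel>p\<^sup>n\<parallel> + \<Delta>t \<parallel>\<partial>\<eta>\<^sup>n\<parallel>\<close>, so that the load enters through its \<open>L\<^sup>1\<close> norm in time, which is at most
  \<open>sqrt T\<close> times its \<open>L\<^sup>2\<close> norm in time.

  \<^emph>\<open>The function spaces.\<close>  All of this is linear algebra in a space with two semi-inner products.
  That \<open>L\<^sup>2\<close> and \<open>H\<^sup>1\<^sub>0\<close> provide such a space requires the weak gradient to be linear up to
  null sets and the closure of the test functions in the \<open>H\<^sup>1\<close> norm to be a linear space.  The first follows
  from uniqueness of weak gradients (\<open>du_bois_reymond\<close>, which needs smooth bump functions), the second
  also from the fact that a test function has its classical gradient as weak gradient
  (\<open>test_function_in_H1\<close>, by translation invariance of the Lebesgue integral).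
\<close>

section \<open>Smooth bump functions\<close>

lemma C_k_const: "C_k k (\<lambda>x. c)"
proof (induction k arbitrary: c)
  case (Suc k)
  have "frechet_derivative (\<lambda>x::'a. c) (at x) = (\<lambda>v. 0)" for x
    by (rule frechet_derivative_at[symmetric]) simp
  then show ?case
    using Suc.IH[of 0] by simp
qed simp

text \<open>The induction in \<open>C_k_mult\<close> relies on this: the product rule multiplies a derivative by an
  undifferentiated factor, which has to be lowered to the same order.\<close>

lemma C_k_SucD: "C_k (Suc k) g \<Longrightarrow> C_k k g"
proof (induction k arbitrary: g)
  case 0
  then show ?case
    by (simp add: differentiable_imp_continuous_within continuous_at_imp_continuous_on)
qed (metis C_k.simps(2))

lemma C_k_add:
  assumes "C_k k f" and "C_k k g"
  shows "C_k k (\<lambda>x. f x + g x)"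
  using assms
proof (induction k arbitrary: f g)
  case 0
  then show ?case by (simp add: continuous_on_add)
next
  case (Suc k)
  have f: "(f has_derivative frechet_derivative f (at x)) (at x)"
    and g: "(g has_derivative frechet_derivative g (at x)) (at x)" for x
    using Suc.prems by (simp_all add: frechet_derivative_works[symmetric])
  have "frechet_derivative (\<lambda>x. f x + g x) (at x) =
      (\<lambda>v. frechet_derivative f (at x) v + frechet_derivative g (at x) v)" for x
    by (rule frechet_derivative_at[symmetric]) (intro derivative_intros f g)
  then show ?case
    using Suc by (auto intro!: differentiable_add)
qed

lemma C_k_mult:
  assumes "C_k k f" and "C_k k g"
  shows "C_k k (\<lambda>x. f x * g x)"
  using assms
proof (induction k arbitrary: f g)
  case 0
  then show ?case by (simp add: continuous_on_mult)
next
  case (Suc k)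
  have f: "(f has_derivative frechet_derivative f (at x)) (at x)"
    and g: "(g has_derivative frechet_derivative g (at x)) (at x)" for x
    using Suc.prems by (simp_all add: frechet_derivative_works[symmetric])
  have D: "frechet_derivative (\<lambda>x. f x * g x) (at x) =
      (\<lambda>v. f x * frechet_derivative g (at x) v + frechet_derivative f (at x) v * g x)" for x
    by (rule frechet_derivative_at[symmetric]) (intro derivative_intros f g)
  have "C_k k f" "C_k k g"
    using Suc.prems C_k_SucD by blast+
  then show ?case
    using Suc D by (auto intro!: differentiable_mult C_k_add)
qed

lemma C_k_cmult: "C_k k f \<Longrightarrow> C_k k (\<lambda>x. c * f x)"
  using C_k_mult[OF C_k_const] by blast

lemma C_k_prod:
  assumes "finite I" "\<And>i. i \<in> I \<Longrightarrow> C_k k (f i)"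
  shows "C_k k (\<lambda>x. \<Prod>i\<in>I. f i x)"
  using assms by (induction I rule: finite_induct) (auto intro: C_k_const C_k_mult)

lemma C_k_power: "C_k k f \<Longrightarrow> C_k k (\<lambda>x. f x ^ n)"
  by (induction n) (auto intro: C_k_const C_k_mult)

text \<open>The factor \<open>1 / t ^ j\<close> makes the family closed under differentiation up to linear combinations
  (\<open>flat_exp_has_derivative\<close>), so that smoothness of all its members follows by a single induction on
  the order; the standard flat function is the member \<open>j = 0\<close>.\<close>

definition flat_exp :: "nat \<Rightarrow> real \<Rightarrow> real" where
  "flat_exp j t = (if t > 0 then exp (- (1 / t)) / t ^ j else 0)"

lemma flat_exp_tendsto_0: "(flat_exp j \<longlongrightarrow> 0) (at 0)"
proof (rule filterlim_split_at)
  show "(flat_exp j \<longlongrightarrow> 0) (at_left 0)"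
    by (rule Lim_transform_eventually[OF tendsto_const])
       (auto simp: eventually_at_left_field flat_exp_def intro: exI[of _ "-1"])
  have "((\<lambda>t. inverse t ^ j / exp (inverse t)) \<longlongrightarrow> (0::real)) (at_right 0)"
    by (rule filterlim_compose[OF tendsto_power_div_exp_0 filterlim_inverse_at_top_right])
  then show "(flat_exp j \<longlongrightarrow> 0) (at_right 0)"
    by (rule Lim_transform_eventually)
       (auto simp: eventually_at_right_field flat_exp_def exp_minus field_simps intro!: exI[of _ 1])
qed

lemma flat_exp_has_derivative:
  "(flat_exp j has_real_derivative flat_exp (j + 2) t - real j * flat_exp (j + 1) t) (at t)"
proof (cases t "0::real" rule: linorder_cases)
  case less
  have "((\<lambda>t. 0) has_real_derivative 0) (at t)" by simp
  then have "(flat_exp j has_real_derivative 0) (at t)"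
    by (rule has_field_derivative_transform_within_open[where S = "{..<0}"])
       (use less in \<open>auto simp: flat_exp_def\<close>)
  then show ?thesis using less by (simp add: flat_exp_def)
next
  case equal
  have "((\<lambda>y. (flat_exp j y - flat_exp j 0) / (y - 0)) \<longlongrightarrow> 0) (at 0)"
    by (rule Lim_transform_eventually[OF flat_exp_tendsto_0[of "Suc j"]])
       (auto simp: eventually_at_filter flat_exp_def)
  then show ?thesis
    using equal by (simp add: has_field_derivative_iff flat_exp_def)
next
  case greater
  have "((\<lambda>t. exp (- (1 / t)) / t ^ j) has_real_derivative
      flat_exp (j + 2) t - real j * flat_exp (j + 1) t) (at t)"
    using greater
    apply (auto intro!: derivative_eq_intros simp: flat_exp_def power2_eq_square field_simps)
    apply (cases j; simp add: field_simps)
    done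
  then show ?thesis
    by (rule has_field_derivative_transform_within_open[where S = "{0<..}"])
       (use greater in \<open>auto simp: flat_exp_def\<close>)
qed

lemma C_k_flat_exp_affine:
  fixes b :: "'a::euclidean_space"
  shows "C_k k (\<lambda>x. flat_exp j (x \<bullet> b + c))"
proof (induction k arbitrary: j)
  case 0
  have "continuous_on UNIV (flat_exp j)"
    using flat_exp_has_derivative DERIV_isCont by (blast intro: continuous_at_imp_continuous_on)
  then show ?case
    by (auto intro!: continuous_on_compose2[of UNIV "flat_exp j"] continuous_intros)
next
  case (Suc k)
  have D: "((\<lambda>x. flat_exp j (x \<bullet> b + c)) has_derivative
      (\<lambda>v. (v \<bullet> b) * (flat_exp (j + 2) (x \<bullet> b + c) - real j * flat_exp (j + 1) (x \<bullet> b + c))))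
      (at x)" for x
    by (rule has_derivative_compose[of "\<lambda>x. x \<bullet> b + c", OF _
          flat_exp_has_derivative[unfolded has_field_derivative_def], THEN has_derivative_eq_rhs])
       (auto intro!: derivative_eq_intros simp: mult.commute)
  have E: "frechet_derivative (\<lambda>x. flat_exp j (x \<bullet> b + c)) (at x) =
      (\<lambda>v. (v \<bullet> b) * (flat_exp (j + 2) (x \<bullet> b + c) + (- real j) * flat_exp (j + 1) (x \<bullet> b + c)))" for x
    using frechet_derivative_at[OF D] by (simp add: algebra_simps)
  have "C_k k (\<lambda>x. (v \<bullet> b) * (flat_exp (j + 2) (x \<bullet> b + c) + (- real j) * flat_exp (j + 1) (x \<bullet> b + c)))" for v
    by (intro C_k_cmult C_k_add Suc.IH)
  then show ?case
    using D unfolding C_k.simps E differentiable_def by blast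
qed

definition box_bump :: "'a::euclidean_space \<Rightarrow> 'a \<Rightarrow> 'a \<Rightarrow> real" where
  "box_bump a c x = (\<Prod>b\<in>Basis. flat_exp 0 (x \<bullet> b + - (a \<bullet> b)) * flat_exp 0 (x \<bullet> (- b) + c \<bullet> b))"

lemma flat_exp_0_bounds: "0 \<le> flat_exp 0 t" "flat_exp 0 t \<le> 1"
  by (auto simp: flat_exp_def)

lemma box_bump_bounds: "0 \<le> box_bump a c x" "box_bump a c x \<le> 1"
  unfolding box_bump_def
  by (auto intro!: prod_nonneg prod_le_1 mult_nonneg_nonneg mult_le_one flat_exp_0_bounds)

lemma box_bump_eq_0_iff: "box_bump a c x = 0 \<longleftrightarrow> x \<notin> box a c"
proof -
  have "flat_exp 0 t = 0 \<longleftrightarrow> t \<le> 0" for t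
    by (auto simp: flat_exp_def)
  then show ?thesis
    by (auto simp: box_bump_def mem_box algebra_simps) (meson not_le)+
qed

lemma C_k_box_bump: "C_k k (box_bump a c)"
  unfolding box_bump_def[abs_def] by (intro C_k_prod C_k_mult C_k_flat_exp_affine) auto

text \<open>These functions approximate the indicator of the box: for a bump \<open>p\<close> that takes values in
  \<open>[0, 1]\<close> and is positive exactly on the box, \<open>1 - (1 - p)\<^sup>n\<close> is a polynomial
  in \<open>p\<close>, so it is smooth with the same support, and it increases to the indicator.\<close>

lemma box_test_function:
  assumes "cbox a c \<subseteq> \<Omega>"
  shows "(\<lambda>x. 1 + (-1) * (1 + (-1) * box_bump a c x) ^ n) \<in> test_functions \<Omega>"
proof -
  let ?p = "\<lambda>x. 1 + (-1) * (1 + (-1) * box_bump a c x) ^ n"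
  have "{x. ?p x \<noteq> 0} \<subseteq> cbox a c"
  proof
    fix x assume "x \<in> {x. ?p x \<noteq> 0}"
    then have "box_bump a c x \<noteq> 0" by auto
    then show "x \<in> cbox a c"
      using box_subset_cbox[of a c] by (auto simp: box_bump_eq_0_iff)
  qed
  then have "closure {x. ?p x \<noteq> 0} \<subseteq> cbox a c"
    by (rule closure_minimal) (rule closed_cbox)
  moreover from this have "compact (closure {x. ?p x \<noteq> 0})"
    using bounded_cbox bounded_subset compact_eq_bounded_closed by blast
  moreover have "C_k k ?p" for k
    by (intro C_k_add C_k_cmult C_k_power C_k_const C_k_box_bump)
  ultimately show ?thesis
    using assms unfolding test_functions_def by blast
qed

lemma box_test_function_tendsto:
  "(\<lambda>n. 1 + (-1) * (1 + (-1) * box_bump a c x) ^ n) \<longlonglongrightarrow> indicator (box a c) x"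
proof (cases "x \<in> box a c")
  case True
  then have "box_bump a c x > 0"
    using box_bump_bounds(1) box_bump_eq_0_iff by (metis order_le_less)
  then have "(\<lambda>n. (1 + (-1) * box_bump a c x) ^ n) \<longlonglongrightarrow> 0"
    using box_bump_bounds(2)[of a c x] \<open>box_bump a c x > 0\<close>
    by (intro LIMSEQ_power_zero) (simp add: abs_if)
  then have "(\<lambda>n. 1 + (-1) * (1 + (-1) * box_bump a c x) ^ n) \<longlonglongrightarrow> 1 + (-1) * 0"
    by (rule tendsto_add[OF tendsto_const tendsto_mult[OF tendsto_const]])
  then show ?thesis using True by simp
next
  case False
  then have "box_bump a c x = 0" by (simp add: box_bump_eq_0_iff)
  then show ?thesis using False by simp
qed

section \<open>The fundamental lemma of the calculus of variations\<close>

text \<open>Boxes generate the Borel sets and are stable under intersection, so the integral vanishes over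
  every Borel set by Dynkin's argument.  The whole space, needed for complements, is the limit of boxes.\<close>

lemma AE_zero_of_box_integrals:
  fixes G :: "'a::euclidean_space \<Rightarrow> real"
  assumes G: "integrable lborel G"
    and zero: "\<And>a c. (LINT x:box a c|lborel. G x) = 0"
  shows "AE x in lborel. G x = 0"
proof (rule sigma_finite_measure.density_zero[OF sigma_finite_lborel G])
  have si: "set_integrable lborel A G" if "A \<in> sets borel" for A
    using integrable_mult_indicator[OF _ G, of A] that unfolding set_integrable_def by simp
  let ?A = "\<lambda>n::nat. box (- (real n *\<^sub>R One)) (real n *\<^sub>R One) :: 'a set"
  have un: "(\<Union>n. ?A n) = UNIV"
    by (fact UN_box_eq_UNIV)
  have "incseq ?A"
    by (auto simp: incseq_def intro!: subset_box_imp)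
  then have "(\<lambda>n. LINT x:?A n|lborel. G x) \<longlonglongrightarrow> (LINT x:(\<Union>n. ?A n)|lborel. G x)"
    by (intro set_integral_cont_up si) (auto simp: un)
  then have all: "(LINT x:UNIV|lborel. G x) = 0"
    unfolding un zero using LIMSEQ_unique tendsto_const by blast
  fix A :: "'a set" assume "A \<in> sets lborel"
  then have A: "A \<in> sigma_sets UNIV (range (\<lambda>(a, c). box a c))"
    unfolding sets_lborel borel_eq_box by simp
  have "Int_stable (range (\<lambda>(a, c). box a c :: 'a set))"
    and "range (\<lambda>(a, c). box a c :: 'a set) \<subseteq> Pow UNIV"
    by (auto simp: Int_stable_def box_Int_box)
  from this A show "(LINT x:A|lborel. G x) = 0"
  proof (induction rule: sigma_sets_induct_disjoint)
    case (basic A)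
    then show ?case using zero by auto
  next
    case empty
    then show ?case by (simp add: set_lebesgue_integral_def)
  next
    case (compl A)
    then have A: "A \<in> sets borel"
      by (simp add: borel_eq_box)
    have "(LINT x:A \<union> (UNIV - A)|lborel. G x) = (LINT x:A|lborel. G x) + (LINT x:UNIV - A|lborel. G x)"
      using A by (intro set_integral_Un si) auto
    then show ?case using all compl by simp
  next
    case (union A)
    then have A: "A i \<in> sets borel" for i
      by (auto simp: borel_eq_box)
    have "(LINT x:(\<Union>i. A i)|lborel. G x) = (\<Sum>i. LINT x:A i|lborel. G x)"
      using A union by (intro lebesgue_integral_countable_add si) (auto simp: disjoint_family_on_def)
    then show ?case using union by simp
  qed
qed

text \<open>Testing with \<open>1 - (1 - p)\<^sup>n\<close> and letting \<open>n\<close> grow shows that \<open>f\<close> has integral zero over each box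
  whose closure lies in \<open>\<Omega>\<close>.  Such boxes cover \<open>\<Omega>\<close> countably, which makes the conclusion local.\<close>

lemma du_bois_reymond:
  fixes f :: "'a::euclidean_space \<Rightarrow> real"
  assumes "open \<Omega>" and f: "integrable (lebesgue_on \<Omega>) f"
    and zero: "\<And>\<psi>. \<psi> \<in> test_functions \<Omega> \<Longrightarrow> (\<integral>x. f x * \<psi> x \<partial>(lebesgue_on \<Omega>)) = 0"
  shows "AE x in lebesgue_on \<Omega>. f x = 0"
proof -
  have \<Omega>: "\<Omega> \<inter> space lebesgue \<in> sets lebesgue"
    using assms(1) by auto
  define F where "F = (\<lambda>x. indicator \<Omega> x * f x)"
  have F: "integrable lebesgue F"
    using f unfolding integrable_restrict_space[OF \<Omega>] F_def by simp
  then obtain G where G[measurable]: "G \<in> borel_measurable lborel" and FG: "AE x in lborel. F x = G x"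
    using completion_ex_borel_measurable_real[of F lborel] by auto
  have FG': "AE x in lebesgue. F x = G x"
    using FG by (rule AE_completion)
  have "integrable lebesgue G"
    using F FG' G by (subst integrable_cong_AE[of _ _ F]) (auto intro: measurable_completion)
  then have Gi: "integrable lborel G"
    using integrable_completion[OF G] by simp
  have box0: "(LINT x:box a c|lborel. G x) = 0" if ac: "cbox a c \<subseteq> \<Omega>" for a c
  proof -
    let ?\<psi> = "\<lambda>n (x::'a). 1 + (-1) * (1 + (-1) * box_bump a c x) ^ n"
    have m[measurable]: "box_bump a c \<in> borel_measurable borel"
      using C_k_box_bump[of 0 a c] by (simp add: borel_measurable_continuous_onI)
    have le: "\<bar>?\<psi> n x\<bar> \<le> 1" for n and x :: 'a
      using box_bump_bounds[of a c x] power_le_one[of "1 - box_bump a c x" n]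
        zero_le_power[of "1 - box_bump a c x" n] by auto
    have "(\<lambda>n. \<integral>x. G x * ?\<psi> n x \<partial>lborel) \<longlonglongrightarrow> (\<integral>x. G x * indicator (box a c) x \<partial>lborel)"
    proof (rule integral_dominated_convergence[where w = "\<lambda>x. \<bar>G x\<bar>"])
      show "AE x in lborel. (\<lambda>n. G x * ?\<psi> n x) \<longlonglongrightarrow> G x * indicator (box a c) x"
        by (intro AE_I2 tendsto_mult tendsto_const box_test_function_tendsto)
      show "AE x in lborel. norm (G x * ?\<psi> n x) \<le> \<bar>G x\<bar>" for n
        using le[where n = n] by (auto simp: abs_mult intro!: mult_left_le)
    qed (use Gi in auto)
    moreover have "(\<integral>x. G x * ?\<psi> n x \<partial>lborel) = 0" for n
    proof -
      have "(\<integral>x. G x * ?\<psi> n x \<partial>lborel) = (\<integral>x. G x * ?\<psi> n x \<partial>lebesgue)"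
        by (rule integral_completion[symmetric]) measurable
      also have "\<dots> = (\<integral>x. F x * ?\<psi> n x \<partial>lebesgue)"
      proof (rule integral_cong_AE)
        have \<psi>: "(\<lambda>x. ?\<psi> n x) \<in> borel_measurable lebesgue"
          by (rule measurable_completion) measurable
        show "(\<lambda>x. G x * ?\<psi> n x) \<in> borel_measurable lebesgue"
          by (rule borel_measurable_times[OF measurable_completion[OF G] \<psi>])
        show "(\<lambda>x. F x * ?\<psi> n x) \<in> borel_measurable lebesgue"
          by (rule borel_measurable_times[OF borel_measurable_integrable[OF F] \<psi>])
        show "AE x in lebesgue. G x * ?\<psi> n x = F x * ?\<psi> n x"
          using FG' by eventually_elim simp
      qed
      also have "\<dots> = (\<integral>x. f x * ?\<psi> n x \<partial>(lebesgue_on \<Omega>))"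
        by (simp add: integral_restrict_space[OF \<Omega>] F_def mult.assoc)
      also have "\<dots> = 0"
        by (rule zero[OF box_test_function[OF ac]])
      finally show ?thesis .
    qed
    ultimately show ?thesis
      using LIMSEQ_unique[OF _ tendsto_const] by (auto simp: set_lebesgue_integral_def mult.commute)
  qed
  have loc: "AE x in lborel. x \<in> box a c \<longrightarrow> G x = 0" if ac: "cbox a c \<subseteq> \<Omega>" for a c
  proof -
    have "AE x in lborel. indicator (box a c) x * G x = 0"
    proof (rule AE_zero_of_box_integrals)
      show "integrable lborel (\<lambda>x. indicator (box a c) x * G x)"
        using integrable_mult_indicator[OF _ Gi, of "box a c"] by simp
      fix a' c' :: 'a
      obtain p q where pq: "box a' c' \<inter> box a c = box p q"
        using box_Int_box by blast
      have "(LINT x:box a' c'|lborel. indicator (box a c) x * G x) = (LINT x:box p q|lborel. G x)"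
        unfolding set_lebesgue_integral_def pq[symmetric]
        by (rule Bochner_Integration.integral_cong) (auto simp: indicator_def)
      also have "\<dots> = 0"
      proof (cases "box p q = {}")
        case False
        then have "cbox p q \<subseteq> cbox a c"
          using pq closure_mono[of "box p q" "box a c"] closure_box[of p q]
          by (cases "box a c = {}") auto
        then show ?thesis using box0 ac by blast
      qed (simp add: set_lebesgue_integral_def)
      finally show "(LINT x:box a' c'|lborel. indicator (box a c) x * G x) = 0" .
    qed
    then show ?thesis by (auto simp: indicator_def)
  qed
  obtain D where D: "countable D" "\<And>X. X \<in> D \<Longrightarrow> \<exists>a c. X = cbox a c" "\<And>X. X \<in> D \<Longrightarrow> X \<subseteq> \<Omega>" "\<Union>D = \<Omega>"
    using open_countable_Union_open_cbox[OF assms(1)] by (metis PowD subsetD)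
  have "AE x in lborel. x \<in> X \<longrightarrow> G x = 0" if X: "X \<in> D" for X
  proof -
    obtain a c where ac: "X = cbox a c"
      using D X by blast
    have "cbox a c - box a c \<in> null_sets lborel"
      using negligible_frontier_interval[of a c]
      by (simp add: negligible_iff_null_sets null_sets_completion_iff)
    then have "AE x in lborel. x \<notin> cbox a c - box a c"
      by (rule AE_not_in)
    moreover have "AE x in lborel. x \<in> box a c \<longrightarrow> G x = 0"
      using loc D(3)[OF X] ac by blast
    ultimately show ?thesis unfolding ac by eventually_elim auto
  qed
  then have "AE x in lborel. \<forall>X\<in>D. x \<in> X \<longrightarrow> G x = 0"
    using D(1) by (subst AE_ball_countable) auto
  then have "AE x in lborel. x \<in> \<Omega> \<longrightarrow> f x = 0"
    using FG
  proof eventually_elim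
    case (elim x)
    have "f x = 0" if "x \<in> \<Omega>"
    proof -
      have "G x = 0" using elim(1) D(4) that by blast
      then show ?thesis using elim(2) that by (simp add: F_def)
    qed
    then show ?case by blast
  qed
  then show ?thesis
    by (simp add: AE_restrict_space_iff[OF \<Omega>] AE_completion)
qed

section \<open>Integration by parts\<close>

text \<open>Translation invariance makes the integral of each difference quotient in the direction \<open>b\<close> vanish.
  Difference quotients are dominated by a multiple of the indicator of a ball, by the mean value
  theorem, so the limit may be taken under the integral.\<close>

lemma integral_partial_derivative_eq_0:
  fixes F :: "'a::euclidean_space \<Rightarrow> real"
  assumes F: "C_k 1 F" and K: "compact (closure {x. F x \<noteq> 0})"
  shows "(\<integral>x. frechet_derivative F (at x) b \<partial>lborel) = 0"
proof -
  let ?K = "closure {x. F x \<noteq> 0}"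
  define F' where "F' = (\<lambda>x. frechet_derivative F (at x) b)"
  have D: "(F has_derivative frechet_derivative F (at x)) (at x)" for x
    using F by (simp add: frechet_derivative_works[symmetric])
  have cF: "continuous_on UNIV F"
    using F C_k_SucD[of 0 F] by simp
  have cF': "continuous_on UNIV F'"
    using F by (simp add: F'_def)
  have out: "F' x = 0" if "x \<notin> ?K" for x
  proof -
    have "(F has_derivative (\<lambda>_. 0)) (at x)"
      by (rule has_derivative_transform_within_open[where s = "- ?K" and f = "\<lambda>_. 0"])
         (use that closure_subset[of "{x. F x \<noteq> 0}"] in auto)
    then show ?thesis
      using frechet_derivative_at by (metis F'_def)
  qed
  have "bounded (F' ` ?K)"
    by (intro compact_imp_bounded compact_continuous_image K continuous_on_subset[OF cF']) simp
  then obtain L where L: "\<And>x. x \<in> ?K \<Longrightarrow> \<bar>F' x\<bar> \<le> L" and "L > 0"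
    unfolding bounded_pos by auto
  then have L: "\<bar>F' x\<bar> \<le> L" for x
    using out[of x] by (cases "x \<in> ?K") auto
  obtain r where r: "\<And>x. x \<in> ?K \<Longrightarrow> norm x \<le> r"
    using compact_imp_bounded[OF K] unfolding bounded_iff by blast
  \<comment> \<open>The ball of this radius contains the supports of \<open>F\<close> and of its translates by at most \<open>b\<close>.\<close>
  define R where "R = r + norm b"
  define q where "q = (\<lambda>n x. (F (x + inverse (Suc n) *\<^sub>R b) - F x) / inverse (Suc n))"
  have line: "((\<lambda>t. F (x + t *\<^sub>R b)) has_real_derivative F' (x + t *\<^sub>R b)) (at t)" for x t
    unfolding has_field_derivative_def F'_def
    by (rule has_derivative_compose[OF _ D, THEN has_derivative_eq_rhs])
       (auto intro!: derivative_eq_intros ext simp: linear_cmul[OF has_derivative_linear[OF D]])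
  have q_le: "\<bar>q n x\<bar> \<le> L * indicator (cball 0 R) x" for n x
  proof (cases "x \<in> cball 0 R")
    case True
    obtain z where "F (x + inverse (Suc n) *\<^sub>R b) - F (x + 0 *\<^sub>R b)
        = (inverse (Suc n) - 0) * F' (x + z *\<^sub>R b)"
      using MVT2[of 0 "inverse (Suc n)" "\<lambda>t. F (x + t *\<^sub>R b)" "\<lambda>t. F' (x + t *\<^sub>R b)"] line by auto
    then have "q n x = F' (x + z *\<^sub>R b)"
      by (simp add: q_def)
    then show ?thesis using L True by simp
  next
    case False
    have "norm x \<le> norm (x + inverse (Suc n) *\<^sub>R b) + norm (inverse (Suc n) *\<^sub>R b)"
      by (metis add_diff_cancel_right' norm_triangle_ineq4)
    moreover have "norm (inverse (Suc n) *\<^sub>R b) \<le> norm b"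
      using mult_right_mono[of "inverse (Suc n)" 1 "norm b"] by (simp add: inverse_eq_divide)
    ultimately have "norm (x + inverse (Suc n) *\<^sub>R b) > r" "norm x > r"
      using False by (auto simp: R_def) (smt (verit) norm_ge_zero)
    then have "F (x + inverse (Suc n) *\<^sub>R b) = 0" "F x = 0"
      using r closure_subset[of "{x. F x \<noteq> 0}"] by (force simp: not_less)+
    then show ?thesis using False by (simp add: q_def)
  qed
  have m: "F \<in> borel_measurable borel"
    using cF by (rule borel_measurable_continuous_onI)
  have "integrable lborel (\<lambda>x. indicator ?K x *\<^sub>R F x)"
    using K continuous_on_subset[OF cF] by (intro borel_integrable_compact) auto
  moreover have "(\<lambda>x. indicator ?K x *\<^sub>R F x) = F"
    using closure_subset[of "{x. F x \<noteq> 0}"] by (intro ext) (auto simp: indicator_def)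
  ultimately have iF: "integrable lborel F"
    by simp
  have q0: "(\<integral>x. q n x \<partial>lborel) = 0" for n
  proof -
    let ?c = "inverse (Suc n) *\<^sub>R b"
    have "(\<integral>x. F x \<partial>lborel) = (\<integral>x. F x \<partial>(distr lborel borel ((+) ?c)))"
      by (simp add: lborel_distr_plus)
    also have "\<dots> = (\<integral>x. F (?c + x) \<partial>lborel)"
      by (rule integral_distr) (use m in auto)
    finally have "(\<integral>x. F (x + ?c) \<partial>lborel) = (\<integral>x. F x \<partial>lborel)"
      by (simp add: add.commute)
    moreover have "integrable lborel (\<lambda>x. F (x + ?c))"
    proof -
      have "integrable (distr lborel borel ((+) ?c)) F"
        using iF by (simp add: lborel_distr_plus)
      then have "integrable lborel (\<lambda>x. F (?c + x))"
        by (subst (asm) integrable_distr_eq) (use m in auto)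
      then show ?thesis by (simp add: add.commute)
    qed
    ultimately show ?thesis
      using iF unfolding q_def by simp
  qed
  have "(\<lambda>n. \<integral>x. q n x \<partial>lborel) \<longlonglongrightarrow> (\<integral>x. F' x \<partial>lborel)"
  proof (rule integral_dominated_convergence[where w = "\<lambda>x. L * indicator (cball 0 R) x"])
    show "F' \<in> borel_measurable lborel"
      using cF' by (simp add: borel_measurable_continuous_onI)
    show "q n \<in> borel_measurable lborel" for n
      unfolding q_def by (simp, intro borel_measurable_continuous_onI continuous_intros
          continuous_on_compose2[OF cF]) auto
    show "integrable lborel (\<lambda>x. L * indicator (cball 0 R) x :: real)"
      by (intro integrable_mult_right integrable_real_indicator)
         (use emeasure_bounded_finite[of "cball 0 R"] in \<open>auto simp: less_top\<close>)
    show "AE x in lborel. (\<lambda>n. q n x) \<longlonglongrightarrow> F' x"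
    proof (rule AE_I2)
      fix x
      have "((\<lambda>h. (F (x + (0 + h) *\<^sub>R b) - F (x + 0 *\<^sub>R b)) / h) \<longlongrightarrow> F' (x + 0 *\<^sub>R b)) (at 0)"
        using line[of x 0] unfolding DERIV_def .
      moreover have "filterlim (\<lambda>n. inverse (real (Suc n))) (at 0) sequentially"
        by (rule filterlim_atI[OF LIMSEQ_inverse_real_of_nat]) auto
      ultimately show "(\<lambda>n. q n x) \<longlonglongrightarrow> F' x"
        unfolding q_def by (auto dest: filterlim_compose)
    qed
    show "AE x in lborel. norm (q n x) \<le> L * indicator (cball 0 R) x" for n
      using q_le by simp
  qed
  then have "(\<integral>x. F' x \<partial>lborel) = 0"
    using q0 LIMSEQ_unique[OF _ tendsto_const] by simp
  then show ?thesis by (simp add: F'_def)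
qed

section \<open>Square-integrable functions\<close>

lemma L2_mult_integrable:
  assumes "g \<in> L2_space \<Omega>" "h \<in> L2_space \<Omega>"
  shows "integrable (lebesgue_on \<Omega>) (\<lambda>x. g x \<bullet> h x)"
proof (rule Bochner_Integration.integrable_bound)
  show "integrable (lebesgue_on \<Omega>) (\<lambda>x. (norm (g x))\<^sup>2 + (norm (h x))\<^sup>2)"
    using assms by (simp add: L2_space_def)
  show "(\<lambda>x. g x \<bullet> h x) \<in> borel_measurable (lebesgue_on \<Omega>)"
    using assms by (auto simp: L2_space_def)
  have "\<bar>u \<bullet> v\<bar> \<le> (norm u)\<^sup>2 + (norm v)\<^sup>2" for u v :: 'b
    using Cauchy_Schwarz_ineq2[of u v] sum_squares_bound[of "norm u" "norm v"]
      mult_nonneg_nonneg[of "norm u" "norm v"] by simp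
  then show "AE x in lebesgue_on \<Omega>. norm (g x \<bullet> h x) \<le> norm ((norm (g x))\<^sup>2 + (norm (h x))\<^sup>2)"
    by simp
qed

lemma L2_space_lincomb:
  assumes "g \<in> L2_space \<Omega>" "h \<in> L2_space \<Omega>"
  shows "(\<lambda>x. g x + c *\<^sub>R h x) \<in> L2_space \<Omega>"
proof -
  have "(norm (g x + c *\<^sub>R h x))\<^sup>2 = (norm (g x))\<^sup>2 + 2 * c * (g x \<bullet> h x) + c\<^sup>2 * (norm (h x))\<^sup>2" for x
    unfolding power2_norm_eq_inner by (simp add: algebra_simps inner_commute power2_eq_square)
  then show ?thesis
    using assms L2_mult_integrable[OF assms] by (auto simp: L2_space_def)
qed

lemma L2_space_component: "g \<in> L2_space \<Omega> \<Longrightarrow> b \<in> Basis \<Longrightarrow> (\<lambda>x. g x \<bullet> b) \<in> L2_space \<Omega>"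
  unfolding L2_space_def
proof (safe, goal_cases)
  case 1
  then show ?case by simp
next
  case 2
  show ?case
  proof (rule Bochner_Integration.integrable_bound[OF 2(3)])
    show "(\<lambda>x. (norm (g x \<bullet> b))\<^sup>2) \<in> borel_measurable (lebesgue_on \<Omega>)"
      using 2 by simp
    show "AE x in lebesgue_on \<Omega>. norm ((norm (g x \<bullet> b))\<^sup>2) \<le> norm ((norm (g x))\<^sup>2)"
      using 2 Basis_le_norm[OF 2(1)] by (simp add: abs_le_square_iff[symmetric])
  qed
qed

lemma continuous_in_L2_space:
  fixes g :: "'a::euclidean_space \<Rightarrow> 'b::euclidean_space"
  assumes "open \<Omega>" "bounded \<Omega>" "continuous_on UNIV g"
  shows "g \<in> L2_space \<Omega>"
proof -
  have "compact (g ` closure \<Omega>)"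
    using assms by (intro compact_continuous_image continuous_on_subset[OF assms(3)]) auto
  then obtain L where "\<forall>y\<in>g ` closure \<Omega>. norm y \<le> L"
    using compact_imp_bounded[of "g ` closure \<Omega>"] unfolding bounded_iff by meson
  then have L: "norm (g x) \<le> L" if "x \<in> \<Omega>" for x
    using that closure_subset[of \<Omega>] by auto
  have m: "g \<in> borel_measurable (lebesgue_on \<Omega>)"
    using assms(1,3) by (intro continuous_imp_measurable_on_sets_lebesgue continuous_on_subset[OF assms(3)]) auto
  have "finite_measure (lebesgue_on \<Omega>)"
    using assms by (intro finite_measure_lebesgue_on lmeasurable_open) 
  moreover have "AE x in lebesgue_on \<Omega>. norm ((norm (g x))\<^sup>2) \<le> L\<^sup>2"
    using L by (intro AE_I2) (auto intro!: power_mono)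
  ultimately have "integrable (lebesgue_on \<Omega>) (\<lambda>x. (norm (g x))\<^sup>2)"
    using m by (intro finite_measure.integrable_const_bound[where B = "L\<^sup>2"]) auto
  then show ?thesis using m by (simp add: L2_space_def)
qed

section \<open>Semi-inner products on function spaces\<close>

text \<open>The inner product is semidefinite: elements are functions, and those that vanish almost
  everywhere have norm zero without being zero.\<close>

locale semi_inner_space =
  fixes V :: "('a \<Rightarrow> real) set" and ip :: "('a \<Rightarrow> real) \<Rightarrow> ('a \<Rightarrow> real) \<Rightarrow> real"
  assumes zero_in: "(\<lambda>x. 0) \<in> V"
    and lincomb_in: "v \<in> V \<Longrightarrow> w \<in> V \<Longrightarrow> (\<lambda>x. v x + c * w x) \<in> V"
    and sym: "ip v w = ip w v"
    and lin: "v \<in> V \<Longrightarrow> w \<in> V \<Longrightarrow> z \<in> V \<Longrightarrow> ip (\<lambda>x. v x + c * w x) z = ip v z + c * ip w z"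
    and nonneg: "v \<in> V \<Longrightarrow> 0 \<le> ip v v"
begin

definition nrm :: "('a \<Rightarrow> real) \<Rightarrow> real" where
  "nrm v = sqrt (ip v v)"

lemma nrm_nonneg: "v \<in> V \<Longrightarrow> 0 \<le> nrm v"
  by (simp add: nrm_def nonneg)

lemma nrm_power2: "v \<in> V \<Longrightarrow> (nrm v)\<^sup>2 = ip v v"
  by (simp add: nrm_def nonneg)

lemma diff_in: "v \<in> V \<Longrightarrow> w \<in> V \<Longrightarrow> (\<lambda>x. v x - w x) \<in> V"
  using lincomb_in[of v w "-1"] by simp

lemma lin_right: "v \<in> V \<Longrightarrow> w \<in> V \<Longrightarrow> z \<in> V \<Longrightarrow> ip z (\<lambda>x. v x + c * w x) = ip z v + c * ip z w"
  by (simp only: sym[of z "\<lambda>x. v x + c * w x"] sym[of z v] sym[of z w] lin)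

lemma diff: "v \<in> V \<Longrightarrow> w \<in> V \<Longrightarrow> z \<in> V \<Longrightarrow> ip (\<lambda>x. v x - w x) z = ip v z - ip w z"
  using lin[of v w z "-1"] by simp

lemma zero_left: "v \<in> V \<Longrightarrow> ip (\<lambda>x. 0) v = 0"
  using lin[of "\<lambda>x. 0" "\<lambda>x. 0" v 1] zero_in by simp

lemma sum_in:
  assumes "finite I" "\<And>i. i \<in> I \<Longrightarrow> v i \<in> V"
  shows "(\<lambda>x. \<Sum>i\<in>I. c i * v i x) \<in> V"
  using assms
proof (induction I rule: finite_induct)
  case empty
  then show ?case by (simp add: zero_in)
next
  case (insert j I)
  then show ?case
    using lincomb_in[of "\<lambda>x. \<Sum>i\<in>I. c i * v i x" "v j" "c j"] by (simp add: add.commute)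
qed

lemma sum_left:
  assumes "finite I" "\<And>i. i \<in> I \<Longrightarrow> v i \<in> V" "z \<in> V"
  shows "ip (\<lambda>x. \<Sum>i\<in>I. c i * v i x) z = (\<Sum>i\<in>I. c i * ip (v i) z)"
  using assms
proof (induction I rule: finite_induct)
  case empty
  then show ?case by (simp add: zero_left)
next
  case (insert j I)
  have "(\<lambda>x. \<Sum>i\<in>insert j I. c i * v i x) = (\<lambda>x. (\<Sum>i\<in>I. c i * v i x) + c j * v j x)"
    using insert.hyps by (simp add: add.commute)
  moreover have "(\<lambda>x. \<Sum>i\<in>I. c i * v i x) \<in> V"
    using insert by (intro sum_in) auto
  ultimately have "ip (\<lambda>x. \<Sum>i\<in>insert j I. c i * v i x) z
      = ip (\<lambda>x. \<Sum>i\<in>I. c i * v i x) z + c j * ip (v j) z"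
    using insert.prems by (simp add: lin)
  also have "\<dots> = (\<Sum>i\<in>insert j I. c i * ip (v i) z)"
    using insert by simp
  finally show ?case .
qed

lemma square_lincomb:
  assumes "v \<in> V" "w \<in> V"
  shows "ip (\<lambda>x. v x + c * w x) (\<lambda>x. v x + c * w x) = ip v v + 2 * c * ip v w + c\<^sup>2 * ip w w"
proof -
  have "ip (\<lambda>x. v x + c * w x) (\<lambda>x. v x + c * w x)
      = ip v (\<lambda>x. v x + c * w x) + c * ip w (\<lambda>x. v x + c * w x)"
    using assms by (intro lin lincomb_in)
  also have "\<dots> = ip v v + c * ip v w + c * (ip w v + c * ip w w)"
    using assms by (simp add: lin_right)
  finally show ?thesis by (simp add: sym[of w v] algebra_simps power2_eq_square)
qed

lemma Cauchy_Schwarz: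
  assumes v: "v \<in> V" and w: "w \<in> V"
  shows "\<bar>ip v w\<bar> \<le> nrm v * nrm w"
proof -
  have quad: "0 \<le> ip v v + 2 * c * ip v w + c\<^sup>2 * ip w w" for c
    using nonneg[OF lincomb_in[OF v w]] square_lincomb[OF v w] by simp
  have "(ip v w)\<^sup>2 \<le> ip v v * ip w w"
  proof (cases "ip w w = 0")
    case True
    have "ip v w = 0"
    proof (rule ccontr)
      assume "ip v w \<noteq> 0"
      then show False
        using quad[of "- (ip v v + 1) / (2 * ip v w)"] True by (simp add: field_simps)
    qed
    then show ?thesis by (simp add: True)
  next
    case False
    then have "ip w w > 0" using nonneg[OF w] by simp
    moreover have "0 \<le> ip v v - (ip v w)\<^sup>2 / ip w w"
      using quad[of "- ip v w / ip w w"] False by (simp add: power2_eq_square field_simps)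
    ultimately show ?thesis by (simp add: field_simps)
  qed
  then have "sqrt ((ip v w)\<^sup>2) \<le> sqrt (ip v v * ip w w)"
    by (rule real_sqrt_le_mono)
  then show ?thesis by (simp add: nrm_def real_sqrt_mult)
qed

lemma nrm_triangle:
  assumes v: "v \<in> V" and w: "w \<in> V"
  shows "nrm (\<lambda>x. v x + c * w x) \<le> nrm v + \<bar>c\<bar> * nrm w"
proof (rule power2_le_imp_le)
  have "c * ip v w \<le> \<bar>c\<bar> * (nrm v * nrm w)"
    using Cauchy_Schwarz[OF v w] mult_left_mono[of "\<bar>ip v w\<bar>" _ "\<bar>c\<bar>"] abs_ge_self[of "c * ip v w"]
    by (force simp: abs_mult)
  then have "ip v v + 2 * c * ip v w + c\<^sup>2 * ip w w \<le> (nrm v + \<bar>c\<bar> * nrm w)\<^sup>2"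
    using v w by (simp add: power2_sum power_mult_distrib nrm_power2 mult.left_commute)
  then show "(nrm (\<lambda>x. v x + c * w x))\<^sup>2 \<le> (nrm v + \<bar>c\<bar> * nrm w)\<^sup>2"
    using v w by (simp add: nrm_power2 lincomb_in square_lincomb)
  show "0 \<le> nrm v + \<bar>c\<bar> * nrm w"
    using v w by (simp add: nrm_nonneg)
qed

lemma parallelogram_le:
  assumes v: "v \<in> V" and w: "w \<in> V"
  shows "ip (\<lambda>x. v x - w x) (\<lambda>x. v x - w x) \<le> 2 * ip v v + 2 * ip w w"
proof -
  have "0 \<le> ip (\<lambda>x. v x + 1 * w x) (\<lambda>x. v x + 1 * w x)"
    by (intro nonneg lincomb_in v w)
  also have "\<dots> = ip v v + 2 * 1 * ip v w + 1\<^sup>2 * ip w w"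
    by (rule square_lincomb[OF v w])
  finally have "0 \<le> ip v v + 2 * ip v w + ip w w"
    by simp
  moreover have "ip (\<lambda>x. v x - w x) (\<lambda>x. v x - w x) = ip v v + 2 * (-1) * ip v w + (-1)\<^sup>2 * ip w w"
    using square_lincomb[OF v w, of "-1"] by simp
  ultimately show ?thesis by simp
qed

end

lemma semi_inner_add:
  assumes "semi_inner_space V p" "semi_inner_space V q"
  shows "semi_inner_space V (\<lambda>v w. p v w + q v w)"
proof -
  interpret p: semi_inner_space V p by fact
  interpret q: semi_inner_space V q by fact
  show ?thesis
  proof
    show "p v w + q v w = p w v + q w v" for v w
      by (simp only: p.sym[of v w] q.sym[of v w])
    show "p (\<lambda>x. v x + c * w x) z + q (\<lambda>x. v x + c * w x) z
        = p v z + q v z + c * (p w z + q w z)" if "v \<in> V" "w \<in> V" "z \<in> V" for v w z c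
      using that by (simp add: p.lin q.lin algebra_simps)
  qed (auto intro: p.zero_in p.lincomb_in add_nonneg_nonneg p.nonneg q.nonneg)
qed

lemma semi_inner_space_subspace:
  assumes "semi_inner_space V ip" "W \<subseteq> V" "(\<lambda>x. 0) \<in> W"
    and "\<And>v w c. v \<in> W \<Longrightarrow> w \<in> W \<Longrightarrow> (\<lambda>x. v x + c * w x) \<in> W"
  shows "semi_inner_space W ip"
proof -
  interpret semi_inner_space V ip by fact
  show ?thesis
    by standard (use assms(2-4) in \<open>auto intro: sym lin nonneg subsetD\<close>)
qed

section \<open>Weak gradients and the space \<open>H\<^sup>1\<^sub>0\<close>\<close>

locale bounded_open_set =
  fixes \<Omega> :: "'a::euclidean_space set"
  assumes open_set: "open \<Omega>" and bounded_set: "bounded \<Omega>"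
begin

lemma L2_inner_lincomb:
  assumes "g1 \<in> L2_space \<Omega>" "g2 \<in> L2_space \<Omega>" "h \<in> L2_space \<Omega>"
  shows "L2_inner \<Omega> (\<lambda>x. g1 x + c *\<^sub>R g2 x) h = L2_inner \<Omega> g1 h + c * L2_inner \<Omega> g2 h"
  using L2_mult_integrable[OF assms(1,3)] L2_mult_integrable[OF assms(2,3)]
  by (simp add: L2_inner_def inner_add_left)

lemma L2_inner_cong_AE:
  assumes "g \<in> L2_space \<Omega>" "g' \<in> L2_space \<Omega>" "h \<in> L2_space \<Omega>" "h' \<in> L2_space \<Omega>"
    and "AE x in lebesgue_on \<Omega>. g x = g' x" "AE x in lebesgue_on \<Omega>. h x = h' x"
  shows "L2_inner \<Omega> g h = L2_inner \<Omega> g' h'"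
  unfolding L2_inner_def
proof (rule integral_cong_AE)
  show "AE x in lebesgue_on \<Omega>. g x \<bullet> h x = g' x \<bullet> h' x"
    using assms(5,6) by eventually_elim simp
qed (intro borel_measurable_integrable L2_mult_integrable assms)+

lemma L2_inner_commute: "L2_inner \<Omega> g h = L2_inner \<Omega> h g"
  by (simp add: L2_inner_def inner_commute)

lemma L2_inner_nonneg: "0 \<le> L2_inner \<Omega> g g"
  by (simp add: L2_inner_def)

lemma test_function_continuous:
  assumes "\<psi> \<in> test_functions \<Omega>"
  shows "continuous_on UNIV \<psi>" "continuous_on UNIV (\<lambda>x. frechet_derivative \<psi> (at x) b)"
proof -
  have "C_k 0 \<psi>" "C_k 1 \<psi>"
    using assms unfolding test_functions_def by blast+
  then show "continuous_on UNIV \<psi>" "continuous_on UNIV (\<lambda>x. frechet_derivative \<psi> (at x) b)"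
    by simp_all
qed

lemma test_function_L2:
  assumes "\<psi> \<in> test_functions \<Omega>"
  shows "\<psi> \<in> L2_space \<Omega>" "(\<lambda>x. frechet_derivative \<psi> (at x) b) \<in> L2_space \<Omega>"
  using test_function_continuous[OF assms] open_set bounded_set by (auto intro: continuous_in_L2_space)

lemma L2_real_mult_integrable:
  fixes g h :: "'a \<Rightarrow> real"
  shows "g \<in> L2_space \<Omega> \<Longrightarrow> h \<in> L2_space \<Omega> \<Longrightarrow> integrable (lebesgue_on \<Omega>) (\<lambda>x. g x * h x)"
  using L2_mult_integrable[of g \<Omega> h] by simp

lemma is_weak_grad_lincomb:
  assumes w: "w1 \<in> L2_space \<Omega>" "w2 \<in> L2_space \<Omega>"
    and g: "is_weak_grad \<Omega> w1 g1" "is_weak_grad \<Omega> w2 g2"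
  shows "is_weak_grad \<Omega> (\<lambda>x. w1 x + c * w2 x) (\<lambda>x. g1 x + c *\<^sub>R g2 x)"
  unfolding is_weak_grad_def
proof (intro conjI ballI)
  have g_L2: "g1 \<in> L2_space \<Omega>" "g2 \<in> L2_space \<Omega>"
    using g by (auto simp: is_weak_grad_def)
  then show "(\<lambda>x. g1 x + c *\<^sub>R g2 x) \<in> L2_space \<Omega>"
    by (rule L2_space_lincomb)
  fix \<psi> :: "'a \<Rightarrow> real" and b :: 'a
  assume \<psi>: "\<psi> \<in> test_functions \<Omega>" and b: "b \<in> Basis"
  note int = L2_real_mult_integrable[OF w(1) test_function_L2(2)[OF \<psi>, of b]]
    L2_real_mult_integrable[OF w(2) test_function_L2(2)[OF \<psi>, of b]]
    L2_real_mult_integrable[OF L2_space_component[OF g_L2(1) b] test_function_L2(1)[OF \<psi>]]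
    L2_real_mult_integrable[OF L2_space_component[OF g_L2(2) b] test_function_L2(1)[OF \<psi>]]
  have eq: "(\<integral>x. w1 x * frechet_derivative \<psi> (at x) b \<partial>(lebesgue_on \<Omega>))
      = - (\<integral>x. (g1 x \<bullet> b) * \<psi> x \<partial>(lebesgue_on \<Omega>))"
    "(\<integral>x. w2 x * frechet_derivative \<psi> (at x) b \<partial>(lebesgue_on \<Omega>))
      = - (\<integral>x. (g2 x \<bullet> b) * \<psi> x \<partial>(lebesgue_on \<Omega>))"
    using g \<psi> b by (auto simp: is_weak_grad_def)
  show "(\<integral>x. (w1 x + c * w2 x) * frechet_derivative \<psi> (at x) b \<partial>(lebesgue_on \<Omega>))
      = - (\<integral>x. ((g1 x + c *\<^sub>R g2 x) \<bullet> b) * \<psi> x \<partial>(lebesgue_on \<Omega>))"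
    (is "?l = - ?r")
  proof -
    have "?l = (\<integral>x. w1 x * frechet_derivative \<psi> (at x) b
        + c * (w2 x * frechet_derivative \<psi> (at x) b) \<partial>(lebesgue_on \<Omega>))"
      by (rule arg_cong[where f = "integral\<^sup>L _"]) (simp add: fun_eq_iff algebra_simps)
    also have "\<dots> = - ((\<integral>x. (g1 x \<bullet> b) * \<psi> x \<partial>(lebesgue_on \<Omega>))
        + c * (\<integral>x. (g2 x \<bullet> b) * \<psi> x \<partial>(lebesgue_on \<Omega>)))"
      by (simp add: Bochner_Integration.integral_add[OF int(1) integrable_mult_right[OF int(2)]] eq)
    also have "\<dots> = - (\<integral>x. (g1 x \<bullet> b) * \<psi> x + c * ((g2 x \<bullet> b) * \<psi> x) \<partial>(lebesgue_on \<Omega>))"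
      by (simp add: Bochner_Integration.integral_add[OF int(3) integrable_mult_right[OF int(4)]])
    also have "\<dots> = - ?r"
      by (rule arg_cong[where f = "\<lambda>h. - integral\<^sup>L _ h"]) (simp add: fun_eq_iff algebra_simps)
    finally show ?thesis .
  qed
qed

text \<open>The components of the difference are orthogonal to all test functions.\<close>

lemma is_weak_grad_unique:
  assumes g: "is_weak_grad \<Omega> w g" and h: "is_weak_grad \<Omega> w h"
  shows "AE x in lebesgue_on \<Omega>. g x = h x"
proof -
  have gh: "g \<in> L2_space \<Omega>" "h \<in> L2_space \<Omega>"
    using g h by (auto simp: is_weak_grad_def)
  have one: "(\<lambda>x. 1::real) \<in> L2_space \<Omega>"
    using open_set bounded_set by (intro continuous_in_L2_space) auto
  have "AE x in lebesgue_on \<Omega>. g x \<bullet> b = h x \<bullet> b" if b: "b \<in> Basis" for b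
  proof -
    have "AE x in lebesgue_on \<Omega>. g x \<bullet> b - h x \<bullet> b = 0"
    proof (rule du_bois_reymond[OF open_set])
      have "integrable (lebesgue_on \<Omega>) (\<lambda>x. (g x \<bullet> b) * 1 - (h x \<bullet> b) * 1)"
        by (intro Bochner_Integration.integrable_diff L2_real_mult_integrable L2_space_component gh b one)
      then show "integrable (lebesgue_on \<Omega>) (\<lambda>x. g x \<bullet> b - h x \<bullet> b)"
        by (simp only: mult_1_right)
      fix \<psi> :: "'a \<Rightarrow> real" assume \<psi>: "\<psi> \<in> test_functions \<Omega>"
      note int = L2_real_mult_integrable[OF L2_space_component[OF gh(1) b] test_function_L2(1)[OF \<psi>]]
        L2_real_mult_integrable[OF L2_space_component[OF gh(2) b] test_function_L2(1)[OF \<psi>]]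
      have "- (\<integral>x. (g x \<bullet> b) * \<psi> x \<partial>(lebesgue_on \<Omega>)) = (\<integral>x. w x * frechet_derivative \<psi> (at x) b \<partial>(lebesgue_on \<Omega>))"
        using g \<psi> b unfolding is_weak_grad_def by simp
      also have "\<dots> = - (\<integral>x. (h x \<bullet> b) * \<psi> x \<partial>(lebesgue_on \<Omega>))"
        using h \<psi> b unfolding is_weak_grad_def by simp
      finally show "(\<integral>x. (g x \<bullet> b - h x \<bullet> b) * \<psi> x \<partial>(lebesgue_on \<Omega>)) = 0"
        by (simp add: left_diff_distrib Bochner_Integration.integral_diff[OF int])
    qed
    then show ?thesis by simp
  qed
  then have "AE x in lebesgue_on \<Omega>. \<forall>b\<in>Basis. g x \<bullet> b = h x \<bullet> b"
    by (subst AE_ball_countable) (auto intro: countable_finite)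
  then show ?thesis by eventually_elim (auto intro: euclidean_eqI)
qed

lemma weak_grad_works: "w \<in> H1_space \<Omega> \<Longrightarrow> is_weak_grad \<Omega> w (weak_grad \<Omega> w)"
  unfolding H1_space_def weak_grad_def by (auto intro: someI[where P = "is_weak_grad \<Omega> w"])

lemma weak_grad_L2: "w \<in> H1_space \<Omega> \<Longrightarrow> weak_grad \<Omega> w \<in> L2_space \<Omega>"
  using weak_grad_works by (auto simp: is_weak_grad_def)

lemma H1_L2: "w \<in> H1_space \<Omega> \<Longrightarrow> w \<in> L2_space \<Omega>"
  by (simp add: H1_space_def)

lemma H1_lincomb:
  assumes "v \<in> H1_space \<Omega>" "w \<in> H1_space \<Omega>"
  shows "(\<lambda>x. v x + c * w x) \<in> H1_space \<Omega>"
  using is_weak_grad_lincomb[of v w] L2_space_lincomb[of v \<Omega> w c] assms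
  unfolding H1_space_def by auto

lemma weak_grad_lincomb:
  assumes "v \<in> H1_space \<Omega>" "w \<in> H1_space \<Omega>"
  shows "AE x in lebesgue_on \<Omega>.
    weak_grad \<Omega> (\<lambda>x. v x + c * w x) x = weak_grad \<Omega> v x + c *\<^sub>R weak_grad \<Omega> w x"
  by (rule is_weak_grad_unique[OF weak_grad_works is_weak_grad_lincomb])
     (use assms in \<open>auto intro: H1_lincomb H1_L2 weak_grad_works\<close>)

text \<open>An equality, not just one almost everywhere: the two functions have the same set of weak
  gradients, from which the choice operator picks the same element.\<close>

lemma weak_grad_cong_AE:
  assumes "v \<in> L2_space \<Omega>" "w \<in> L2_space \<Omega>" "AE x in lebesgue_on \<Omega>. v x = w x"
  shows "weak_grad \<Omega> v = weak_grad \<Omega> w"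
proof -
  have "(\<integral>x. v x * frechet_derivative \<psi> (at x) b \<partial>(lebesgue_on \<Omega>))
      = (\<integral>x. w x * frechet_derivative \<psi> (at x) b \<partial>(lebesgue_on \<Omega>))"
    if "\<psi> \<in> test_functions \<Omega>" for \<psi> b
    using L2_inner_cong_AE[OF assms(1,2) test_function_L2(2)[OF that] test_function_L2(2)[OF that] assms(3)]
    by (simp add: L2_inner_def)
  then have "is_weak_grad \<Omega> v = is_weak_grad \<Omega> w"
    by (simp add: is_weak_grad_def fun_eq_iff cong: ball_cong)
  then show ?thesis by (simp add: weak_grad_def)
qed

lemma H1_zero: "(\<lambda>x. 0) \<in> H1_space \<Omega>"
proof -
  have "(\<lambda>x. 0::real) \<in> L2_space \<Omega>" "(\<lambda>x. 0::'a) \<in> L2_space \<Omega>"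
    by (simp_all add: L2_space_def)
  then show ?thesis
    by (auto simp: H1_space_def is_weak_grad_def intro!: exI[of _ "\<lambda>x. 0"])
qed

lemma L2_inner_semi_inner: "semi_inner_space (H1_space \<Omega>) (L2_inner \<Omega>)"
proof
  show "L2_inner \<Omega> (\<lambda>x. v x + c * w x) z = L2_inner \<Omega> v z + c * L2_inner \<Omega> w z"
    if "v \<in> H1_space \<Omega>" "w \<in> H1_space \<Omega>" "z \<in> H1_space \<Omega>" for v w z c
    using L2_inner_lincomb[of v w z c] that by (simp add: H1_L2)
  show "L2_inner \<Omega> v w = L2_inner \<Omega> w v" for v w :: "'a \<Rightarrow> real"
    by (rule L2_inner_commute)
qed (rule H1_zero H1_lincomb L2_inner_nonneg | assumption)+

lemma H10_inner_semi_inner: "semi_inner_space (H1_space \<Omega>) (H10_inner \<Omega>)"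
proof
  show "H10_inner \<Omega> (\<lambda>x. v x + c * w x) z = H10_inner \<Omega> v z + c * H10_inner \<Omega> w z"
    if "v \<in> H1_space \<Omega>" "w \<in> H1_space \<Omega>" "z \<in> H1_space \<Omega>" for v w z c
  proof -
    have "H10_inner \<Omega> (\<lambda>x. v x + c * w x) z
        = L2_inner \<Omega> (\<lambda>x. weak_grad \<Omega> v x + c *\<^sub>R weak_grad \<Omega> w x) (weak_grad \<Omega> z)"
      unfolding H10_inner_def
      using that weak_grad_lincomb[OF that(1,2)]
      by (intro L2_inner_cong_AE) (auto intro: weak_grad_L2 H1_lincomb L2_space_lincomb)
    then show ?thesis
      using that by (simp add: H10_inner_def L2_inner_lincomb weak_grad_L2)
  qed
  show "H10_inner \<Omega> v w = H10_inner \<Omega> w v" for v w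
    unfolding H10_inner_def by (rule L2_inner_commute)
  show "0 \<le> H10_inner \<Omega> v v" for v
    unfolding H10_inner_def by (rule L2_inner_nonneg)
qed (rule H1_zero H1_lincomb | assumption)+

text \<open>Integration by parts for two test functions amounts to the integral of a partial derivative of
  their product being zero.\<close>

lemma test_function_in_H1:
  assumes \<psi>: "\<psi> \<in> test_functions \<Omega>"
  shows "\<psi> \<in> H1_space \<Omega>"
proof -
  have \<Omega>: "\<Omega> \<inter> space lebesgue \<in> sets lebesgue"
    using open_set by auto
  define G where "G = (\<lambda>x. \<Sum>b\<in>Basis. frechet_derivative \<psi> (at x) b *\<^sub>R b)"
  have Gb: "G x \<bullet> b = frechet_derivative \<psi> (at x) b" if "b \<in> Basis" for x b
    using that unfolding G_def by (simp add: inner_sum_left inner_Basis if_distrib cong: if_cong)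
  have "is_weak_grad \<Omega> \<psi> G"
    unfolding is_weak_grad_def
  proof (intro conjI ballI)
    show "G \<in> L2_space \<Omega>"
      unfolding G_def using open_set bounded_set test_function_continuous(2)[OF \<psi>]
      by (intro continuous_in_L2_space continuous_intros) auto
    fix \<theta> :: "'a \<Rightarrow> real" and b :: 'a
    assume \<theta>: "\<theta> \<in> test_functions \<Omega>" and b: "b \<in> Basis"
    have C: "C_k 1 \<psi>" "C_k 1 \<theta>"
      using \<psi> \<theta> unfolding test_functions_def by blast+
    define F where "F = (\<lambda>x. \<psi> x * \<theta> x)"
    have D: "(\<psi> has_derivative frechet_derivative \<psi> (at x)) (at x)"
      "(\<theta> has_derivative frechet_derivative \<theta> (at x)) (at x)" for x
      using C by (simp_all add: frechet_derivative_works[symmetric])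
    have dF: "frechet_derivative F (at x) b
        = \<psi> x * frechet_derivative \<theta> (at x) b + frechet_derivative \<psi> (at x) b * \<theta> x" for x
      unfolding F_def by (subst frechet_derivative_at[OF has_derivative_mult[OF D], symmetric]) (rule refl)
    have out: "\<psi> x = 0" "\<theta> x = 0" if "x \<notin> \<Omega>" for x
      using \<psi> \<theta> that closure_subset[of "{x. \<psi> x \<noteq> 0}"] closure_subset[of "{x. \<theta> x \<noteq> 0}"]
      by (auto simp: test_functions_def)
    have CF: "C_k 1 F"
      unfolding F_def using C by (rule C_k_mult)
    have "closure {x. F x \<noteq> 0} \<subseteq> closure {x. \<psi> x \<noteq> 0}"
      by (rule closure_mono) (auto simp: F_def)
    then have "compact (closure {x. F x \<noteq> 0})"
      using \<psi> compact_Int_closed[OF _ closed_closure, of "closure {x. \<psi> x \<noteq> 0}" "{x. F x \<noteq> 0}"]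
      by (simp add: test_functions_def Int_absorb1)
    then have "0 = (\<integral>x. frechet_derivative F (at x) b \<partial>lborel)"
      using integral_partial_derivative_eq_0[OF CF] by simp
    also have "\<dots> = (\<integral>x. frechet_derivative F (at x) b \<partial>lebesgue)"
      using CF by (intro integral_completion[symmetric]) (auto intro: borel_measurable_continuous_onI)
    also have "\<dots> = (\<integral>x. indicator \<Omega> x *\<^sub>R frechet_derivative F (at x) b \<partial>lebesgue)"
      by (rule Bochner_Integration.integral_cong) (auto simp: indicator_def dF out)
    also have "\<dots> = (\<integral>x. frechet_derivative F (at x) b \<partial>(lebesgue_on \<Omega>))"
      by (rule integral_restrict_space[OF \<Omega>, symmetric])
    also have "\<dots> = (\<integral>x. \<psi> x * frechet_derivative \<theta> (at x) b \<partial>(lebesgue_on \<Omega>))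
        + (\<integral>x. frechet_derivative \<psi> (at x) b * \<theta> x \<partial>(lebesgue_on \<Omega>))"
      unfolding dF
      by (intro Bochner_Integration.integral_add L2_real_mult_integrable test_function_L2 \<psi> \<theta>)
    finally show "(\<integral>x. \<psi> x * frechet_derivative \<theta> (at x) b \<partial>(lebesgue_on \<Omega>))
        = - (\<integral>x. (G x \<bullet> b) * \<theta> x \<partial>(lebesgue_on \<Omega>))"
      using b by (simp add: Gb)
  qed
  then show ?thesis
    using test_function_L2(1)[OF \<psi>] by (auto simp: H1_space_def)
qed

lemma test_function_lincomb:
  assumes "\<psi> \<in> test_functions \<Omega>" "\<theta> \<in> test_functions \<Omega>"
  shows "(\<lambda>x. \<psi> x + c * \<theta> x) \<in> test_functions \<Omega>"
proof -
  let ?S = "\<lambda>\<psi>::'a \<Rightarrow> real. closure {x. \<psi> x \<noteq> 0}"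
  have "?S (\<lambda>x. \<psi> x + c * \<theta> x) \<subseteq> closure ({x. \<psi> x \<noteq> 0} \<union> {x. \<theta> x \<noteq> 0})"
    by (rule closure_mono) auto
  also have "\<dots> = ?S \<psi> \<union> ?S \<theta>"
    by simp
  finally have sub: "?S (\<lambda>x. \<psi> x + c * \<theta> x) \<subseteq> ?S \<psi> \<union> ?S \<theta>" .
  moreover have "compact (?S \<psi> \<union> ?S \<theta>)"
    using assms by (simp add: test_functions_def compact_Un)
  ultimately have "compact (?S (\<lambda>x. \<psi> x + c * \<theta> x))"
    using compact_Int_closed[OF _ closed_closure, of "?S \<psi> \<union> ?S \<theta>" "{x. \<psi> x + c * \<theta> x \<noteq> 0}"]
    by (simp add: Int_absorb1)
  moreover have "C_k k (\<lambda>x. \<psi> x + c * \<theta> x)" for k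
    using assms by (intro C_k_add C_k_cmult) (auto simp: test_functions_def)
  moreover have "?S (\<lambda>x. \<psi> x + c * \<theta> x) \<subseteq> \<Omega>"
    using assms sub by (auto simp: test_functions_def)
  ultimately show ?thesis
    unfolding test_functions_def by simp
qed

lemma H10_subset_H1: "H10_space \<Omega> \<subseteq> H1_space \<Omega>"
  by (auto simp: H10_space_def)

text \<open>Approximating sequences are combined term by term.  The triangle inequality for the \<open>H\<^sup>1\<close> norm
  may be applied to the differences because test functions belong to \<open>H\<^sup>1\<close> themselves.\<close>

lemma H10_lincomb:
  assumes v: "v \<in> H10_space \<Omega>" and w: "w \<in> H10_space \<Omega>"
  shows "(\<lambda>x. v x + c * w x) \<in> H10_space \<Omega>"
proof -
  interpret H1: semi_inner_space "H1_space \<Omega>" "\<lambda>v w. L2_inner \<Omega> v w + H10_inner \<Omega> v w"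
    by (intro semi_inner_add L2_inner_semi_inner H10_inner_semi_inner)
  have nrm: "H1_norm \<Omega> z = H1.nrm z" for z
    unfolding H1.nrm_def unfolding H1_norm_def L2_norm_def H10_inner_def by (simp add: L2_inner_nonneg)
  obtain \<psi> \<theta> where \<psi>: "\<And>k. \<psi> k \<in> test_functions \<Omega>" "(\<lambda>k. H1.nrm (\<lambda>x. v x - \<psi> k x)) \<longlonglongrightarrow> 0"
    and \<theta>: "\<And>k. \<theta> k \<in> test_functions \<Omega>" "(\<lambda>k. H1.nrm (\<lambda>x. w x - \<theta> k x)) \<longlonglongrightarrow> 0"
    using v w unfolding H10_space_def nrm by blast
  have V: "v \<in> H1_space \<Omega>" "w \<in> H1_space \<Omega>"
    using v w H10_subset_H1 by auto
  have in1: "(\<lambda>x. v x - \<psi> k x) \<in> H1_space \<Omega>" "(\<lambda>x. w x - \<theta> k x) \<in> H1_space \<Omega>" for k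
    using V \<psi>(1) \<theta>(1) by (auto intro: H1.diff_in test_function_in_H1)
  have "(\<lambda>k. H1.nrm (\<lambda>x. (v x + c * w x) - (\<psi> k x + c * \<theta> k x))) \<longlonglongrightarrow> 0"
  proof (rule tendsto_sandwich[OF _ _ tendsto_const])
    have eq: "(\<lambda>x. (v x + c * w x) - (\<psi> k x + c * \<theta> k x)) = (\<lambda>x. (v x - \<psi> k x) + c * (w x - \<theta> k x))" for k
      by (auto simp: algebra_simps)
    show "\<forall>\<^sub>F k in sequentially. 0 \<le> H1.nrm (\<lambda>x. (v x + c * w x) - (\<psi> k x + c * \<theta> k x))"
      unfolding eq by (intro always_eventually allI H1.nrm_nonneg H1.lincomb_in in1)
    show "\<forall>\<^sub>F k in sequentially. H1.nrm (\<lambda>x. (v x + c * w x) - (\<psi> k x + c * \<theta> k x))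
        \<le> H1.nrm (\<lambda>x. v x - \<psi> k x) + \<bar>c\<bar> * H1.nrm (\<lambda>x. w x - \<theta> k x)"
      unfolding eq by (intro always_eventually allI H1.nrm_triangle in1)
    have "(\<lambda>k. H1.nrm (\<lambda>x. v x - \<psi> k x) + \<bar>c\<bar> * H1.nrm (\<lambda>x. w x - \<theta> k x)) \<longlonglongrightarrow> 0 + \<bar>c\<bar> * 0"
      by (intro tendsto_intros \<psi> \<theta>)
    then show "(\<lambda>k. H1.nrm (\<lambda>x. v x - \<psi> k x) + \<bar>c\<bar> * H1.nrm (\<lambda>x. w x - \<theta> k x)) \<longlonglongrightarrow> 0"
      by simp
  qed
  then show ?thesis
    using V H1_lincomb test_function_lincomb[OF \<psi>(1) \<theta>(1)]
    unfolding H10_space_def nrm by (auto intro!: exI[of _ "\<lambda>k x. \<psi> k x + c * \<theta> k x"])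
qed

end

section \<open>Energy estimates for backward Euler\<close>

context semi_inner_space
begin

lemma diff_quot_in: "v \<in> V \<Longrightarrow> w \<in> V \<Longrightarrow> (\<lambda>x. (v x - w x) / d) \<in> V"
  using lincomb_in[OF zero_in diff_in[of v w], of "1 / d"] by simp

lemma diff_quot_left:
  assumes "v \<in> V" "w \<in> V" "z \<in> V"
  shows "ip (\<lambda>x. (v x - w x) / d) z = (ip v z - ip w z) / d"
  using lin[OF zero_in diff_in[OF assms(1,2)] assms(3), of "1 / d"] assms
  by (simp add: zero_left diff)

lemma sum_sum:
  assumes I: "finite I" and v: "\<And>i. i \<in> I \<Longrightarrow> v i \<in> V"
  shows "ip (\<lambda>x. \<Sum>i\<in>I. c i * v i x) (\<lambda>x. \<Sum>i\<in>I. c i * v i x)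
    = (\<Sum>i\<in>I. \<Sum>j\<in>I. c i * c j * ip (v i) (v j))"
proof -
  let ?z = "\<lambda>x. \<Sum>i\<in>I. c i * v i x"
  have z: "?z \<in> V" by (rule sum_in[OF I v])
  have "ip ?z ?z = (\<Sum>i\<in>I. c i * ip (v i) ?z)"
    by (rule sum_left[OF I v z])
  also have "\<dots> = (\<Sum>i\<in>I. c i * (\<Sum>j\<in>I. c j * ip (v i) (v j)))"
  proof (rule sum.cong[OF refl])
    fix i assume i: "i \<in> I"
    have "ip (v i) ?z = ip ?z (v i)" by (rule sym)
    also have "\<dots> = (\<Sum>j\<in>I. c j * ip (v j) (v i))"
      by (rule sum_left[OF I v v[OF i]])
    also have "\<dots> = (\<Sum>j\<in>I. c j * ip (v i) (v j))"
      by (rule sum.cong[OF refl]) (rule arg_cong[OF sym])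
    finally show "c i * ip (v i) ?z = c i * (\<Sum>j\<in>I. c j * ip (v i) (v j))" by simp
  qed
  finally show ?thesis by (simp add: sum_distrib_left mult.assoc)
qed

end

lemma square_of_weighted_sum_le:
  fixes Q :: "nat \<Rightarrow> real"
  assumes "1 \<le> N"
  shows "(\<Sum>n=1..<N. dt * Q n)\<^sup>2 \<le> dt * real (N - 1) * (dt * (\<Sum>n=1..<N. (Q n)\<^sup>2))"
proof -
  have "(\<Sum>n=1..<N. Q n)\<^sup>2 \<le> real (N - 1) * (\<Sum>n=1..<N. (Q n)\<^sup>2)"
    using Cauchy_Schwarz_ineq_sum[of "\<lambda>_. 1" Q "{1..<N}"] by simp
  then have "dt\<^sup>2 * (\<Sum>n=1..<N. Q n)\<^sup>2 \<le> dt\<^sup>2 * (real (N - 1) * (\<Sum>n=1..<N. (Q n)\<^sup>2))"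
    by (intro mult_left_mono) auto
  then show ?thesis
    by (simp add: sum_distrib_left[symmetric] power_mult_distrib power2_eq_square mult.assoc mult.left_commute)
qed

text \<open>Both the \<open>L\<^sup>2\<close> norm and the gradient energy grow by a bounded amount per step, and the sum of
  these amounts over the whole time interval bounds the value at each time.\<close>

lemma growth_bound:
  fixes P d :: "nat \<Rightarrow> real"
  assumes step: "\<And>n. n \<in> {1..<N} \<Longrightarrow> P (Suc n) \<le> P n + d n"
    and d: "\<And>n. n \<in> {1..<N} \<Longrightarrow> 0 \<le> d n"
    and k: "k \<in> {1..N}"
  shows "P k \<le> P 1 + (\<Sum>n=1..<N. d n)"
proof -
  have "1 \<le> k" "k \<le> N" using k by auto
  then have "P k \<le> P 1 + (\<Sum>n=1..<k. d n)"
  proof (induction k rule: dec_induct)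
    case (step n)
    then show ?case using assms(1)[of n] by simp
  qed simp
  also have "(\<Sum>n=1..<k. d n) \<le> (\<Sum>n=1..<N. d n)"
    using k d by (intro sum_mono2) auto
  finally show ?thesis by simp
qed

text \<open>A sequence is its initial value plus the sum of its increments, and by Cauchy-Schwarz in time the
  latter is at most \<open>sqrt T\<close> times the discrete \<open>L\<^sup>2\<close> norm in time of the difference quotients.  This is
  why collecting the difference quotients in the POD data yields bounds at every time that do not
  degenerate as \<open>N\<close> grows.\<close>

lemma (in semi_inner_space) pointwise_in_time_bound:
  assumes z: "\<And>n. n \<in> {1..N} \<Longrightarrow> z n \<in> V" and dt: "dt > 0" and T: "dt * real (N - 1) = T"
    and k: "k \<in> {1..N}"
  shows "ip (z k) (z k) \<le> 2 * (1 + T) * (ip (z 1) (z 1)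
    + dt * (\<Sum>n=1..<N. ip (diff_quot dt z n) (diff_quot dt z n)))"
    (is "_ \<le> 2 * (1 + T) * (_ + ?E)")
proof -
  have N: "1 \<le> N" and T0: "0 \<le> T" using k dt T by auto
  define D where "D = (\<Sum>n=1..<N. dt * nrm (diff_quot dt z n))"
  have dq: "diff_quot dt z n \<in> V" if "n \<in> {1..<N}" for n
    unfolding diff_quot_def using that by (intro diff_quot_in z) auto
  have E: "dt * (\<Sum>n=1..<N. (nrm (diff_quot dt z n))\<^sup>2) = ?E"
    using dq by (simp add: nrm_power2)
  have E0: "0 \<le> ?E"
    using dt dq by (intro mult_nonneg_nonneg sum_nonneg nonneg) auto
  have "nrm (z k) \<le> nrm (z 1) + D"
    unfolding D_def
  proof (rule growth_bound[OF _ _ k, where P = "\<lambda>k. nrm (z k)"])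
    fix n assume n: "n \<in> {1..<N}"
    have "z (Suc n) = (\<lambda>x. z n x + dt * diff_quot dt z n x)"
      using dt by (auto simp: diff_quot_def)
    then show "nrm (z (Suc n)) \<le> nrm (z n) + dt * nrm (diff_quot dt z n)"
      using nrm_triangle[OF z dq[OF n], of n dt] n dt by simp
    show "0 \<le> dt * nrm (diff_quot dt z n)"
      using dt nrm_nonneg[OF dq[OF n]] by simp
  qed
  then have "(nrm (z k))\<^sup>2 \<le> (nrm (z 1) + D)\<^sup>2"
    using nrm_nonneg[OF z[OF k]] by (intro power_mono)
  also have "\<dots> \<le> 2 * (nrm (z 1))\<^sup>2 + 2 * D\<^sup>2"
    using sum_squares_bound[of "nrm (z 1)" D] by (simp add: power2_sum)
  also have "D\<^sup>2 \<le> T * ?E"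
    unfolding D_def using square_of_weighted_sum_le[OF N, of dt "\<lambda>n. nrm (diff_quot dt z n)"]
    by (simp only: E T)
  finally have "ip (z k) (z k) \<le> 2 * ip (z 1) (z 1) + 2 * (T * ?E)"
    using z k N by (simp add: nrm_power2)
  also have "\<dots> \<le> 2 * (1 + T) * (ip (z 1) (z 1) + ?E)"
    using T0 E0 nonneg[OF z[of 1]] N by (simp add: algebra_simps)
  finally show ?thesis .
qed

text \<open>Backward Euler in a trial space \<open>W\<close> with mass form \<open>m\<close>, energy form \<open>a\<close> and load \<open>q\<close>, which
  takes values in the larger space \<open>V\<close>.\<close>

locale discrete_parabolic =
  m: semi_inner_space V m + a: semi_inner_space V a
  for V :: "('a \<Rightarrow> real) set" and m a +
  fixes W :: "('a \<Rightarrow> real) set" and p q :: "nat \<Rightarrow> 'a \<Rightarrow> real" and \<nu> dt T :: real and N :: nat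
  assumes \<nu>: "\<nu> > 0" and dt: "dt > 0" and N: "1 \<le> N" and T: "dt * real (N - 1) = T"
    and W: "W \<subseteq> V" and W_diff: "\<And>v w. v \<in> W \<Longrightarrow> w \<in> W \<Longrightarrow> (\<lambda>x. v x - w x) \<in> W"
    and p: "\<And>n. n \<in> {1..N} \<Longrightarrow> p n \<in> W"
    and q: "\<And>n. n \<in> {1..<N} \<Longrightarrow> q n \<in> V"
    and scheme: "\<And>n v. n \<in> {1..<N} \<Longrightarrow> v \<in> W \<Longrightarrow>
      m (diff_quot dt p n) v + \<nu> * a (p (Suc n)) v = m (q n) v"
begin

definition load_L2_sq where "load_L2_sq = dt * (\<Sum>n=1..<N. m (q n) (q n))"

lemma p_V: "n \<in> {1..N} \<Longrightarrow> p n \<in> V"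
  using p W by blast

lemma scheme_dt:
  assumes n: "n \<in> {1..<N}" and v: "v \<in> W"
  shows "m (p (Suc n)) v - m (p n) v + dt * \<nu> * a (p (Suc n)) v = dt * m (q n) v"
proof -
  have "m (diff_quot dt p n) v = (m (p (Suc n)) v - m (p n) v) / dt"
    unfolding diff_quot_def using m.diff_quot_left[of "p (Suc n)" "p n" v dt] n v W p_V by auto
  then have "dt * m (diff_quot dt p n) v = m (p (Suc n)) v - m (p n) v"
    using dt by simp
  moreover have "dt * (m (diff_quot dt p n) v + \<nu> * a (p (Suc n)) v) = dt * m (q n) v"
    by (simp only: scheme[OF n v])
  ultimately show ?thesis
    by (simp add: distrib_left mult.assoc)
qed

text \<open>Testing with the increment \<open>d\<close> of \<open>p\<close>: the load term is absorbed by \<open>m d d\<close> through Young's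
  inequality, and \<open>a (p + d) d \<ge> (a (p + d) (p + d) - a p p) / 2\<close>.\<close>

lemma a_step:
  assumes n: "n \<in> {1..<N}"
  shows "a (p (Suc n)) (p (Suc n)) \<le> a (p n) (p n) + dt * m (q n) (q n) / (2 * \<nu>)"
proof -
  let ?d = "\<lambda>x. p (Suc n) x - p n x"
  have pV: "p (Suc n) \<in> V" "p n \<in> V"
    using n p_V by auto
  have pW: "p (Suc n) \<in> W" "p n \<in> W"
    using n p by auto
  have d: "?d \<in> V" by (rule m.diff_in[OF pV])
  have "m ?d ?d + dt * \<nu> * a (p (Suc n)) ?d = dt * m (q n) ?d"
    using scheme_dt[OF n W_diff[OF pW]] m.diff[OF pV d] by simp
  \<comment> \<open>Young's inequality, from the square of \<open>d - (dt / 2) q\<close>\<close>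
  also have "dt * m (q n) ?d \<le> m ?d ?d + dt\<^sup>2 * m (q n) (q n) / 4"
    using m.nonneg[OF m.lincomb_in[OF d q[OF n], of "- dt / 2"]]
      m.square_lincomb[OF d q[OF n], of "- dt / 2"] m.sym[of ?d "q n"]
    by (simp add: power2_eq_square)
  finally have "dt * (\<nu> * a (p (Suc n)) ?d) \<le> dt * (dt * m (q n) (q n) / 4)"
    by (simp add: power2_eq_square)
  then have "\<nu> * a (p (Suc n)) ?d \<le> dt * m (q n) (q n) / 4"
    using dt by simp
  moreover have "a (p (Suc n)) ?d \<ge> (a (p (Suc n)) (p (Suc n)) - a (p n) (p n)) / 2"
    using a.nonneg[OF d] a.square_lincomb[OF pV, of "-1"] a.lin_right[OF pV pV(1), of "-1"] by simp
  then have "\<nu> * a (p (Suc n)) ?d \<ge> \<nu> * ((a (p (Suc n)) (p (Suc n)) - a (p n) (p n)) / 2)"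
    using \<nu> by (intro mult_left_mono) auto
  ultimately have "\<nu> * ((a (p (Suc n)) (p (Suc n)) - a (p n) (p n)) / 2) \<le> dt * m (q n) (q n) / 4"
    by linarith
  then show ?thesis using \<nu> by (simp add: field_simps)
qed

lemma a_bound:
  assumes k: "k \<in> {1..N}"
  shows "a (p k) (p k) \<le> a (p 1) (p 1) + load_L2_sq / (2 * \<nu>)"
proof -
  have "a (p k) (p k) \<le> a (p 1) (p 1) + (\<Sum>n=1..<N. dt * m (q n) (q n) / (2 * \<nu>))"
    using a_step \<nu> dt m.nonneg[OF q]
    by (intro growth_bound[OF _ _ k, where P = "\<lambda>n. a (p n) (p n)"]) auto
  then show ?thesis
    by (simp add: load_L2_sq_def sum_distrib_left sum_divide_distrib)
qed

text \<open>Testing with the new value, discarding the nonnegative dissipation and dividing by the norm of the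
  new value.\<close>

lemma m_step:
  assumes n: "n \<in> {1..<N}"
  shows "m.nrm (p (Suc n)) \<le> m.nrm (p n) + dt * m.nrm (q n)"
proof -
  have pV: "p (Suc n) \<in> V" "p n \<in> V" and pW: "p (Suc n) \<in> W"
    using n p_V p by auto
  have "0 \<le> dt * \<nu> * a (p (Suc n)) (p (Suc n))"
    using a.nonneg[OF pV(1)] \<nu> dt by simp
  then have "m (p (Suc n)) (p (Suc n)) \<le> m (p n) (p (Suc n)) + dt * m (q n) (p (Suc n))"
    using scheme_dt[OF n pW] by linarith
  also have "\<dots> \<le> m.nrm (p n) * m.nrm (p (Suc n)) + dt * (m.nrm (q n) * m.nrm (p (Suc n)))"
    using m.Cauchy_Schwarz[OF pV(2,1)] m.Cauchy_Schwarz[OF q[OF n] pV(1)] dt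
    by (intro add_mono mult_left_mono) auto
  finally have "m.nrm (p (Suc n)) * m.nrm (p (Suc n))
      \<le> (m.nrm (p n) + dt * m.nrm (q n)) * m.nrm (p (Suc n))"
    using m.nrm_power2[OF pV(1)] by (simp add: power2_eq_square algebra_simps)
  moreover have "0 \<le> m.nrm (p n) + dt * m.nrm (q n)"
    using m.nrm_nonneg[OF pV(2)] m.nrm_nonneg[OF q[OF n]] dt by simp
  ultimately show ?thesis
    using m.nrm_nonneg[OF pV(1)] by (cases "m.nrm (p (Suc n)) = 0") (auto simp: mult_le_cancel_right)
qed

definition load_L1 where "load_L1 = (\<Sum>n=1..<N. dt * m.nrm (q n))"

lemma load_L1_power2_le: "load_L1\<^sup>2 \<le> T * load_L2_sq"
proof -
  have "dt * (\<Sum>n=1..<N. (m.nrm (q n))\<^sup>2) = load_L2_sq"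
    using q by (simp add: load_L2_sq_def m.nrm_power2)
  then show ?thesis
    unfolding load_L1_def using square_of_weighted_sum_le[OF N, of dt "\<lambda>n. m.nrm (q n)"]
    by (simp only: T)
qed

lemma nrm_bound:
  assumes k: "k \<in> {1..N}"
  shows "m.nrm (p k) \<le> m.nrm (p 1) + load_L1"
  unfolding load_L1_def using m_step m.nrm_nonneg[OF q] dt
  by (intro growth_bound[OF _ _ k, where P = "\<lambda>k. m.nrm (p k)"]) auto

lemma m_bound:
  assumes k: "k \<in> {1..N}"
  shows "m (p k) (p k) \<le> 2 * m (p 1) (p 1) + 2 * T * load_L2_sq"
proof -
  have "(m.nrm (p k))\<^sup>2 \<le> (m.nrm (p 1) + load_L1)\<^sup>2"
    using nrm_bound[OF k] m.nrm_nonneg[OF p_V[OF k]] by (intro power_mono)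
  also have "\<dots> \<le> 2 * (m.nrm (p 1))\<^sup>2 + 2 * load_L1\<^sup>2"
    using sum_squares_bound[of "m.nrm (p 1)" load_L1] by (simp add: power2_sum)
  finally show ?thesis
    using load_L1_power2_le k N by (simp add: m.nrm_power2 p_V)
qed

text \<open>Testing with the new value again, this time keeping the dissipation: the load is paired with the
  uniform bound for \<open>p\<close> and the differences of \<open>m (p n) (p n)\<close> telescope.\<close>

lemma dissipation_bound:
  "\<nu> * dt * (\<Sum>n=1..<N. a (p (Suc n)) (p (Suc n))) \<le> m (p 1) (p 1) + 3 / 2 * (T * load_L2_sq)"
proof -
  let ?M = "m.nrm (p 1) + load_L1"
  have step: "m (p (Suc n)) (p (Suc n)) - m (p n) (p n) + 2 * (dt * \<nu> * a (p (Suc n)) (p (Suc n)))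
      \<le> 2 * (dt * m.nrm (q n) * ?M)" if n: "n \<in> {1..<N}" for n
  proof -
    have pV: "p (Suc n) \<in> V" "p n \<in> V" and pW: "p (Suc n) \<in> W"
      using n p_V p by auto
    have "m (p (Suc n)) (p (Suc n)) - m (p n) (p n) \<le> 2 * (m (p (Suc n)) (p (Suc n)) - m (p n) (p (Suc n)))"
      using m.nonneg[OF m.diff_in[OF pV]] m.square_lincomb[OF pV, of "-1"] m.sym[of "p n" "p (Suc n)"]
      by simp
    moreover have "dt * m (q n) (p (Suc n)) \<le> dt * (m.nrm (q n) * ?M)"
    proof (rule mult_left_mono)
      have "m (q n) (p (Suc n)) \<le> m.nrm (q n) * m.nrm (p (Suc n))"
        using m.Cauchy_Schwarz[OF q[OF n] pV(1)] by simp
      also have "\<dots> \<le> m.nrm (q n) * ?M"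
        using nrm_bound[of "Suc n"] n m.nrm_nonneg[OF q[OF n]] by (intro mult_left_mono) auto
      finally show "m (q n) (p (Suc n)) \<le> m.nrm (q n) * ?M" .
    qed (use dt in simp)
    ultimately show ?thesis
      using scheme_dt[OF n pW] by simp
  qed
  have "m (p N) (p N) - m (p 1) (p 1) + 2 * (\<nu> * dt * (\<Sum>n=1..<N. a (p (Suc n)) (p (Suc n))))
      = (\<Sum>n=1..<N. m (p (Suc n)) (p (Suc n)) - m (p n) (p n) + 2 * (dt * \<nu> * a (p (Suc n)) (p (Suc n))))"
    unfolding sum.distrib using sum_Suc_diff'[of 1 N "\<lambda>n. m (p n) (p n)"] N
    by (simp add: sum_distrib_left mult.commute mult.left_commute)
  also have "\<dots> \<le> (\<Sum>n=1..<N. 2 * (dt * m.nrm (q n) * ?M))"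
    by (rule sum_mono) (rule step)
  also have "\<dots> = 2 * (load_L1 * ?M)"
    by (simp add: load_L1_def sum_distrib_left sum_distrib_right)
  finally have "2 * (\<nu> * dt * (\<Sum>n=1..<N. a (p (Suc n)) (p (Suc n)))) \<le> m (p 1) (p 1) + 2 * (load_L1 * ?M)"
    using m.nonneg[OF p_V[of N]] N by simp
  also have "\<dots> \<le> 2 * m (p 1) (p 1) + 3 * load_L1\<^sup>2"
    using sum_squares_bound[of "m.nrm (p 1)" load_L1] m.nrm_power2[OF p_V[of 1]] N
    by (simp add: algebra_simps power2_eq_square)
  finally show ?thesis using load_L1_power2_le by simp
qed

end

section \<open>Completeness of the right singular vectors\<close>

definition S_weight :: "real \<Rightarrow> nat \<Rightarrow> real" where
  "S_weight dt k = (if k = 1 then 1 else dt)"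

lemma sum_S_weight:
  assumes "1 \<le> N"
  shows "(\<Sum>k=1..N. S_weight dt k * g k) = g 1 + dt * (\<Sum>k=2..N. g k)"
proof -
  have "{1..N} = insert 1 {2..N}" using assms by auto
  then show ?thesis
    by (simp add: S_weight_def sum_distrib_left)
qed

lemma S_inner_eq: "1 \<le> N \<Longrightarrow> S_inner dt N g h = (\<Sum>k=1..N. S_weight dt k * (g k * h k))"
  by (simp only: sum_S_weight S_inner_def)

lemma S_inner_semi_inner:
  assumes "0 \<le> dt"
  shows "semi_inner_space UNIV (S_inner dt N)"
proof
  show "S_inner dt N g h = S_inner dt N h g" for g h
    by (simp add: S_inner_def mult.commute)
  show "S_inner dt N (\<lambda>k. g k + c * h k) z = S_inner dt N g z + c * S_inner dt N h z" for g h z c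
    by (simp add: S_inner_def algebra_simps sum.distrib sum_distrib_left)
  show "0 \<le> S_inner dt N g g" for g
    using assms by (simp add: S_inner_def sum_nonneg)
qed auto

text \<open>In matrix terms: from \<open>Q Q\<^sup>T = 1\<close> for a square matrix follows \<open>Q\<^sup>T Q = 1\<close>.  By Bessel's inequality
  for the unit vectors each diagonal entry of \<open>Q\<^sup>T Q\<close> is at most \<open>1\<close>; its trace is the trace \<open>N\<close> of \<open>Q Q\<^sup>T\<close>,
  so equality holds in each, and every unit vector equals its own Fourier expansion.\<close>

lemma orthonormal_completeness:
  assumes on: "orthonormal_on (S_inner dt N) {1..N} \<xi>" and dt: "dt > 0"
    and j: "j \<in> {1..N}" and k: "k \<in> {1..N}"
  shows "S_weight dt j * (\<Sum>i=1..N. \<xi> i j * \<xi> i k) = (if j = k then 1 else 0)"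
proof -
  interpret S: semi_inner_space UNIV "S_inner dt N"
    using dt by (intro S_inner_semi_inner) simp
  have N: "1 \<le> N" using j by simp
  have wpos: "S_weight dt k > 0" for k
    using dt by (simp add: S_weight_def)
  let ?w = "S_weight dt"
  let ?e = "\<lambda>j k. if k = j then 1 else 0 :: real"
  let ?z = "\<lambda>j k. \<Sum>i=1..N. (?w j * \<xi> i j) * \<xi> i k"
  have e: "S_inner dt N v (?e j) = ?w j * v j" if "j \<in> {1..N}" for v j
    unfolding S_inner_eq[OF N] using that by (simp add: if_distrib sum.delta cong: if_cong)
  have \<xi>: "S_inner dt N (\<xi> i) (\<xi> l) = (if i = l then 1 else 0)" if "i \<in> {1..N}" "l \<in> {1..N}" for i l
    using on that by (simp add: orthonormal_on_def)
  \<comment> \<open>Bessel's inequality is the nonnegativity of this squared residual.\<close>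
  have res: "S_inner dt N (\<lambda>k. ?e j k - ?z j k) (\<lambda>k. ?e j k - ?z j k)
      = ?w j * (1 - ?w j * (\<Sum>i=1..N. (\<xi> i j)\<^sup>2))" if j: "j \<in> {1..N}" for j
  proof -
    have "S_inner dt N (?z j) (?z j) = (\<Sum>i=1..N. \<Sum>l=1..N. (?w j * \<xi> i j) * (?w j * \<xi> l j) * (if i = l then 1 else 0))"
      unfolding S.sum_sum[of "{1..N}" \<xi>, OF finite_atLeastAtMost UNIV_I]
      by (intro sum.cong refl arg_cong2[where f = "(*)"] \<xi>)
    also have "\<dots> = (\<Sum>i=1..N. (?w j * \<xi> i j)\<^sup>2)"
      by (intro sum.cong refl) (simp add: if_distrib sum.delta power2_eq_square cong: if_cong)
    finally have zz: "S_inner dt N (?z j) (?z j) = (?w j)\<^sup>2 * (\<Sum>i=1..N. (\<xi> i j)\<^sup>2)"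
      by (simp add: power_mult_distrib sum_distrib_left)
    have "S_inner dt N (?z j) (?e j) = ?w j * ?z j j"
      by (rule e[OF j])
    then have "S_inner dt N (?e j) (?z j) = ?w j * ?z j j"
      using S.sym[of "?e j" "?z j"] by simp
    also have "\<dots> = (?w j)\<^sup>2 * (\<Sum>i=1..N. (\<xi> i j)\<^sup>2)"
      by (simp add: sum_distrib_left power2_eq_square mult.assoc)
    finally have ez: "S_inner dt N (?e j) (?z j) = (?w j)\<^sup>2 * (\<Sum>i=1..N. (\<xi> i j)\<^sup>2)" .
    have "S_inner dt N (\<lambda>k. ?e j k + (-1) * ?z j k) (\<lambda>k. ?e j k + (-1) * ?z j k)
       = S_inner dt N (?e j) (?e j) + 2 * (-1) * S_inner dt N (?e j) (?z j) + (-1)\<^sup>2 * S_inner dt N (?z j) (?z j)"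
      by (rule S.square_lincomb) auto
    then show ?thesis
      unfolding zz ez e[OF j] by (simp add: algebra_simps power2_eq_square)
  qed
  have le: "?w j * (\<Sum>i=1..N. (\<xi> i j)\<^sup>2) \<le> 1" if "j \<in> {1..N}" for j
    using S.nonneg[OF UNIV_I, of "\<lambda>k. ?e j k - ?z j k"] wpos[of j] unfolding res[OF that]
    by (simp add: zero_le_mult_iff)
  \<comment> \<open>The traces agree, so the nonnegative defects of the individual unit vectors sum to zero.\<close>
  have "(\<Sum>j=1..N. 1 - ?w j * (\<Sum>i=1..N. (\<xi> i j)\<^sup>2)) = real N - (\<Sum>j=1..N. \<Sum>i=1..N. ?w j * (\<xi> i j * \<xi> i j))"
    by (simp add: sum_subtractf sum_distrib_left power2_eq_square)
  also have "(\<Sum>j=1..N. \<Sum>i=1..N. ?w j * (\<xi> i j * \<xi> i j)) = (\<Sum>i=1..N. S_inner dt N (\<xi> i) (\<xi> i))"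
    unfolding S_inner_eq[OF N] by (rule sum.swap)
  also have "\<dots> = (\<Sum>i=1..N. 1)"
    by (rule sum.cong) (simp_all add: \<xi>)
  finally have "(\<Sum>j=1..N. 1 - ?w j * (\<Sum>i=1..N. (\<xi> i j)\<^sup>2)) = 0"
    by simp
  then have "\<forall>j\<in>{1..N}. 1 - ?w j * (\<Sum>i=1..N. (\<xi> i j)\<^sup>2) = 0"
    by (subst (asm) sum_nonneg_eq_0_iff) (use le in auto)
  then have "S_inner dt N (\<lambda>k. ?e j k - ?z j k) (\<lambda>k. ?e j k - ?z j k) = 0"
    using res[OF j] j by simp
  moreover have nn: "0 \<le> ?w k * ((?e j k - ?z j k) * (?e j k - ?z j k))" for k
    by (intro mult_nonneg_nonneg less_imp_le[OF wpos] zero_le_square)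
  ultimately have "\<forall>k\<in>{1..N}. ?w k * ((?e j k - ?z j k) * (?e j k - ?z j k)) = 0"
    unfolding S_inner_eq[OF N]
    by (subst (asm) sum_nonneg_eq_0_iff) (simp_all only: finite_atLeastAtMost nn)
  then have "?w k * ((?e j k - ?z j k) * (?e j k - ?z j k)) = 0"
    using k by (rule bspec)
  then have "?z j k = ?e j k"
    using wpos[of k] by (simp only: mult_eq_0_iff right_minus_eq) linarith
  moreover have "?z j k = ?w j * (\<Sum>i=1..N. \<xi> i j * \<xi> i k)"
    by (simp only: sum_distrib_left mult.assoc)
  ultimately show ?thesis
    by (cases "j = k") simp_all
qed

text \<open>The mixed terms cancel because of the orthonormality of the \<open>\<xi> i\<close> in \<open>S\<close>, whether or not the
  \<open>\<phi> i\<close> are orthogonal for \<open>ip\<close>.  So the same identity holds for \<open>L\<^sup>2\<close> and \<open>H\<^sup>1\<^sub>0\<close>.\<close>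

lemma (in semi_inner_space) sum_of_snapshot_squares:
  assumes on: "orthonormal_on (S_inner dt N) {1..N} \<xi>" and N: "1 \<le> N"
    and I: "I \<subseteq> {1..N}" and \<phi>: "\<And>i. i \<in> I \<Longrightarrow> \<phi> i \<in> V"
    and lam: "\<And>i. i \<in> I \<Longrightarrow> 0 \<le> lam i"
  shows "(\<Sum>k=1..N. S_weight dt k *
      ip (\<lambda>x. \<Sum>i\<in>I. (\<xi> i k * sqrt (lam i)) * \<phi> i x) (\<lambda>x. \<Sum>i\<in>I. (\<xi> i k * sqrt (lam i)) * \<phi> i x))
    = (\<Sum>i\<in>I. lam i * ip (\<phi> i) (\<phi> i))"
proof -
  have I_fin: "finite I" using I finite_subset by blast
  let ?g = "\<lambda>i l. sqrt (lam i) * sqrt (lam l) * ip (\<phi> i) (\<phi> l)"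
  have "(\<Sum>k=1..N. S_weight dt k *
      ip (\<lambda>x. \<Sum>i\<in>I. (\<xi> i k * sqrt (lam i)) * \<phi> i x) (\<lambda>x. \<Sum>i\<in>I. (\<xi> i k * sqrt (lam i)) * \<phi> i x))
    = (\<Sum>k=1..N. \<Sum>i\<in>I. \<Sum>l\<in>I. ?g i l * (S_weight dt k * (\<xi> i k * \<xi> l k)))"
  proof (rule sum.cong[OF refl])
    fix k
    show "S_weight dt k *
      ip (\<lambda>x. \<Sum>i\<in>I. (\<xi> i k * sqrt (lam i)) * \<phi> i x) (\<lambda>x. \<Sum>i\<in>I. (\<xi> i k * sqrt (lam i)) * \<phi> i x)
      = (\<Sum>i\<in>I. \<Sum>l\<in>I. ?g i l * (S_weight dt k * (\<xi> i k * \<xi> l k)))"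
      by (subst sum_sum[of I \<phi> "\<lambda>i. \<xi> i k * sqrt (lam i)", OF I_fin \<phi>])
         (assumption, simp only: sum_distrib_left, intro sum.cong refl, simp only: mult_ac)
  qed
  also have "\<dots> = (\<Sum>i\<in>I. \<Sum>k=1..N. \<Sum>l\<in>I. ?g i l * (S_weight dt k * (\<xi> i k * \<xi> l k)))"
    by (rule sum.swap)
  also have "\<dots> = (\<Sum>i\<in>I. \<Sum>l\<in>I. \<Sum>k=1..N. ?g i l * (S_weight dt k * (\<xi> i k * \<xi> l k)))"
    by (intro sum.cong refl sum.swap)
  also have "\<dots> = (\<Sum>i\<in>I. \<Sum>l\<in>I. ?g i l * (if i = l then 1 else 0))"
  proof (intro sum.cong refl)
    fix i l assume "i \<in> I" "l \<in> I"
    then have "S_inner dt N (\<xi> i) (\<xi> l) = (if i = l then 1 else 0)"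
      using on I unfolding orthonormal_on_def by blast
    then show "(\<Sum>k=1..N. ?g i l * (S_weight dt k * (\<xi> i k * \<xi> l k))) = ?g i l * (if i = l then 1 else 0)"
      by (simp only: sum_distrib_left[symmetric] S_inner_eq[OF N])
  qed
  also have "\<dots> = (\<Sum>i\<in>I. lam i * ip (\<phi> i) (\<phi> i))"
    using I_fin lam by (intro sum.cong refl) (simp add: if_distrib sum.delta cong: if_cong)
  finally show ?thesis .
qed

text \<open>Since the eigenvalues are nonincreasing, the positive ones are the first ones.  Hence the sum up to
  the number of positive eigenvalues agrees with the sum over all discarded indices.\<close>

lemma positive_eigenvalue_indices:
  assumes "\<And>i j. i \<in> {1..N} \<Longrightarrow> j \<in> {1..N} \<Longrightarrow> i \<le> j \<Longrightarrow> lam j \<le> (lam i :: real)"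
  shows "{i \<in> {1..N}. lam i > 0} = {1..num_pos_eigenvalues N lam}"
proof (cases "{i \<in> {1..N}. lam i > 0} = {}")
  case True
  then show ?thesis by (simp add: num_pos_eigenvalues_def)
next
  case False
  let ?A = "{i \<in> {1..N}. lam i > 0}"
  have fin: "finite ?A" by simp
  have "?A = {1..Max ?A}"
  proof (rule antisym)
    show "?A \<subseteq> {1..Max ?A}" using Max_ge[OF fin] by auto
    have M: "Max ?A \<in> ?A" using Max_in[OF fin False] .
    show "{1..Max ?A} \<subseteq> ?A"
    proof
      fix i assume i: "i \<in> {1..Max ?A}"
      then have "i \<in> {1..N}" using M by auto
      moreover have "lam (Max ?A) \<le> lam i" using assms[of i "Max ?A"] M i by auto
      ultimately show "i \<in> ?A" using M by auto
    qed
  qed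
  then show ?thesis
    unfolding num_pos_eigenvalues_def by (metis card_atLeastAtMost diff_Suc_1)
qed

section \<open>The POD projection error\<close>

lemma pod_spaceI: "(\<And>x. v x = (\<Sum>j=1..r. c j * \<phi> j x)) \<Longrightarrow> v \<in> pod_space \<phi> r"
  by (auto simp: pod_space_def)

context semi_inner_space
begin

text \<open>Coefficients in the modes are read off by testing with the modes, so the projection is determined
  as a function, everywhere and not just up to null sets.\<close>

lemma projection_onto_pod_space:
  assumes on: "orthonormal_on ip {1..} \<phi>" and \<phi>: "\<And>j. 1 \<le> j \<Longrightarrow> \<phi> j \<in> V" and w: "w \<in> V"
    and R: "Rw \<in> pod_space \<phi> r" and orth: "\<And>v. v \<in> pod_space \<phi> r \<Longrightarrow> ip (\<lambda>x. w x - Rw x) v = 0"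
  shows "Rw = (\<lambda>x. \<Sum>j=1..r. ip w (\<phi> j) * \<phi> j x)"
proof -
  obtain c where c: "Rw = (\<lambda>x. \<Sum>j=1..r. c j * \<phi> j x)"
    using R unfolding pod_space_def by blast
  have RV: "Rw \<in> V"
    unfolding c using \<phi> by (intro sum_in) auto
  have "c i = ip w (\<phi> i)" if i: "i \<in> {1..r}" for i
  proof -
    have "\<phi> i x = (\<Sum>j=1..r. (if j = i then 1 else 0) * \<phi> j x)" for x
      using i by (simp add: if_distrib[of "\<lambda>t. t * _"] sum.delta cong: if_cong)
    then have "\<phi> i \<in> pod_space \<phi> r"
      by (rule pod_spaceI)
    then have "ip w (\<phi> i) = ip Rw (\<phi> i)"
      using orth[of "\<phi> i"] diff[OF w RV \<phi>[of i]] i by simp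
    also have "\<dots> = (\<Sum>j=1..r. c j * ip (\<phi> j) (\<phi> i))"
      unfolding c using \<phi> i by (intro sum_left) auto
    also have "\<dots> = (\<Sum>j=1..r. if j = i then c j else 0)"
      using on i by (intro sum.cong refl) (auto simp: orthonormal_on_def)
    also have "\<dots> = c i" using i by simp
    finally show ?thesis by simp
  qed
  then show ?thesis unfolding c by (intro ext sum.cong) auto
qed

lemma residual_diff_quot:
  assumes z: "v \<in> V" "w \<in> V" and \<phi>: "\<And>j. j \<in> {1..r} \<Longrightarrow> \<phi> j \<in> V"
  shows "((v x - (\<Sum>j=1..r. ip v (\<phi> j) * \<phi> j x)) - (w x - (\<Sum>j=1..r. ip w (\<phi> j) * \<phi> j x))) / d
    = (v x - w x) / d - (\<Sum>j=1..r. ip (\<lambda>x. (v x - w x) / d) (\<phi> j) * \<phi> j x)"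
proof -
  have "(\<Sum>j=1..r. ip (\<lambda>x. (v x - w x) / d) (\<phi> j) * \<phi> j x)
      = (\<Sum>j=1..r. (ip v (\<phi> j) * \<phi> j x - ip w (\<phi> j) * \<phi> j x) / d)"
    using z \<phi> by (intro sum.cong refl) (simp add: diff_quot_left left_diff_distrib)
  also have "\<dots> = ((\<Sum>j=1..r. ip v (\<phi> j) * \<phi> j x) - (\<Sum>j=1..r. ip w (\<phi> j) * \<phi> j x)) / d"
    by (simp only: sum_divide_distrib[symmetric] sum_subtractf)
  finally show ?thesis by (simp only: diff_divide_distrib[symmetric]) (simp add: algebra_simps)
qed

end

lemma pod_space_diff:
  assumes "v \<in> pod_space \<phi> r" "w \<in> pod_space \<phi> r"
  shows "(\<lambda>x. v x - w x) \<in> pod_space \<phi> r"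
proof -
  obtain c d where "v = (\<lambda>x. \<Sum>j=1..r. c j * \<phi> j x)" "w = (\<lambda>x. \<Sum>j=1..r. d j * \<phi> j x)"
    using assms unfolding pod_space_def by blast
  then have "v x - w x = (\<Sum>j=1..r. (c j - d j) * \<phi> j x)" for x
    by (simp add: sum_subtractf left_diff_distrib)
  then show ?thesis
    by (rule pod_spaceI)
qed

lemma pod_space_subset_conforming_space:
  assumes Vh: "conforming_space \<Omega> Vh" and \<phi>: "\<And>j. j \<in> {1..r} \<Longrightarrow> \<phi> j \<in> Vh"
  shows "pod_space \<phi> r \<subseteq> Vh"
proof
  obtain B where B: "Vh = {\<lambda>x. \<Sum>b\<in>B. c b * b x |c. True}"
    using Vh unfolding conforming_space_def by blast
  have "\<forall>j. \<exists>c. j \<in> {1..r} \<longrightarrow> \<phi> j = (\<lambda>x. \<Sum>b\<in>B. c b * b x)"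
    using \<phi> unfolding B by blast
  then obtain c where c: "\<And>j. j \<in> {1..r} \<Longrightarrow> \<phi> j = (\<lambda>x. \<Sum>b\<in>B. c j b * b x)"
    by metis
  fix v assume "v \<in> pod_space \<phi> r"
  then obtain d where d: "v = (\<lambda>x. \<Sum>j=1..r. d j * \<phi> j x)"
    unfolding pod_space_def by blast
  have "v x = (\<Sum>b\<in>B. (\<Sum>j=1..r. d j * c j b) * b x)" for x
  proof -
    have "v x = (\<Sum>j=1..r. \<Sum>b\<in>B. d j * (c j b * b x))"
      unfolding d by (intro sum.cong refl) (simp add: c sum_distrib_left)
    also have "\<dots> = (\<Sum>b\<in>B. \<Sum>j=1..r. d j * (c j b * b x))"
      by (rule sum.swap)
    finally show ?thesis
      by (simp only: sum_distrib_right mult.assoc)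
  qed
  then have "v = (\<lambda>x. \<Sum>b\<in>B. (\<Sum>j=1..r. d j * c j b) * b x)"
    by (rule ext)
  then show "v \<in> Vh" unfolding B by auto
qed

text \<open>The initial value and the difference quotients, numbered like the coordinates of \<open>S\<close>: up to the
  weights of \<open>S\<close> these are the columns of \<open>K1 dt N u\<close>.\<close>

definition snapshot :: "real \<Rightarrow> (nat \<Rightarrow> 'a \<Rightarrow> real) \<Rightarrow> nat \<Rightarrow> 'a \<Rightarrow> real" where
  "snapshot dt u k = (if k = 1 then u 1 else diff_quot dt u (k - 1))"

lemma (in semi_inner_space) snapshot_in:
  assumes z: "\<And>n. n \<in> {1..N} \<Longrightarrow> z n \<in> V" and k: "k \<in> {1..N}"
  shows "snapshot dt z k \<in> V"
proof (cases "k = 1")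
  case False
  then have "(\<lambda>x. (z k x - z (k - 1) x) / dt) \<in> V"
    using k by (intro diff_quot_in z) auto
  then show ?thesis
    using False k by (simp add: snapshot_def diff_quot_def)
qed (use z k in \<open>simp add: snapshot_def\<close>)

lemma sum_snapshot:
  assumes "1 \<le> N"
  shows "(\<Sum>k=1..N. S_weight dt k * F k (snapshot dt u k))
    = F 1 (u 1) + dt * (\<Sum>n=1..<N. F (Suc n) (diff_quot dt u n))"
proof -
  have "(\<Sum>k=2..N. F k (snapshot dt u k)) = (\<Sum>n=1..<N. F (Suc n) (diff_quot dt u n))"
    by (rule sum.reindex_bij_witness[of _ Suc "\<lambda>k. k - 1"]) (auto simp: snapshot_def)
  then show ?thesis
    using assms by (simp only: sum_S_weight) (simp add: snapshot_def)
qed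

lemma K1_snapshot:
  assumes "1 \<le> N"
  shows "K1 dt N u g x = (\<Sum>k=1..N. S_weight dt k * (g k * snapshot dt u k x))"
proof -
  have "{1..N-1} = {1..<N}" using assms by auto
  then show ?thesis
    using sum_snapshot[OF assms, of dt "\<lambda>k y. g k * y x" u]
    by (simp add: K1_def sum_distrib_left mult.assoc)
qed

text \<open>The completeness relation inverts the transform \<open>K1\<close>: it selects the summand of a single snapshot.\<close>

lemma snapshot_expansion:
  assumes "orthonormal_on (S_inner dt N) {1..N} \<xi>" "dt > 0" and k: "k \<in> {1..N}"
  shows "snapshot dt u k x = (\<Sum>i=1..N. \<xi> i k * K1 dt N u (\<xi> i) x)"
proof -
  have N: "1 \<le> N" using k by simp
  let ?y = "snapshot dt u"
  have "(\<Sum>i=1..N. \<xi> i k * K1 dt N u (\<xi> i) x)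
      = (\<Sum>i=1..N. \<Sum>l=1..N. ?y l x * (S_weight dt l * (\<xi> i l * \<xi> i k)))"
    unfolding K1_snapshot[OF N] sum_distrib_left by (intro sum.cong refl) (simp only: mult_ac)
  also have "\<dots> = (\<Sum>l=1..N. \<Sum>i=1..N. ?y l x * (S_weight dt l * (\<xi> i l * \<xi> i k)))"
    by (rule sum.swap)
  also have "\<dots> = (\<Sum>l=1..N. ?y l x * (if l = k then 1 else 0))"
  proof (rule sum.cong[OF refl])
    fix l assume l: "l \<in> {1..N}"
    show "(\<Sum>i=1..N. ?y l x * (S_weight dt l * (\<xi> i l * \<xi> i k))) = ?y l x * (if l = k then 1 else 0)"
      using orthonormal_completeness[OF assms(1,2) l k] by (simp only: sum_distrib_left[symmetric])
  qed
  also have "\<dots> = ?y k x"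
    using k by (simp add: if_distrib sum.delta cong: if_cong)
  finally show ?thesis by simp
qed

context bounded_open_set
begin

lemma H10_zero: "(\<lambda>x. 0) \<in> H10_space \<Omega>"
proof -
  interpret L2: semi_inner_space "H1_space \<Omega>" "L2_inner \<Omega>" by (rule L2_inner_semi_inner)
  interpret H: semi_inner_space "H1_space \<Omega>" "H10_inner \<Omega>" by (rule H10_inner_semi_inner)
  have "(\<lambda>x. 0) \<in> test_functions \<Omega>"
    by (simp add: test_functions_def C_k_const)
  moreover have "H1_norm \<Omega> (\<lambda>x. 0) = 0"
    using L2.zero_left[OF H1_zero] H.zero_left[OF H1_zero]
    by (simp add: H1_norm_def L2_norm_def H10_inner_def)
  ultimately show ?thesis
    using H1_zero by (auto simp: H10_space_def intro!: exI[of _ "\<lambda>k x. 0"])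
qed

lemma L2_inner_on_H10: "semi_inner_space (H10_space \<Omega>) (L2_inner \<Omega>)"
  by (rule semi_inner_space_subspace[OF L2_inner_semi_inner H10_subset_H1 H10_zero H10_lincomb])

lemma H10_inner_on_H10: "semi_inner_space (H10_space \<Omega>) (H10_inner \<Omega>)"
  by (rule semi_inner_space_subspace[OF H10_inner_semi_inner H10_subset_H1 H10_zero H10_lincomb])

lemma conforming_space_subset_H10: "conforming_space \<Omega> Vh \<Longrightarrow> Vh \<subseteq> H10_space \<Omega>"
proof -
  interpret semi_inner_space "H10_space \<Omega>" "L2_inner \<Omega>" by (rule L2_inner_on_H10)
  assume "conforming_space \<Omega> Vh"
  then obtain B where B: "finite B" "B \<subseteq> H10_space \<Omega>" "Vh = {\<lambda>x. \<Sum>b\<in>B. c b * b x |c. True}"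
    unfolding conforming_space_def by blast
  show ?thesis
    unfolding B(3) using sum_in[of B "\<lambda>b. b"] B(1,2) by auto
qed

text \<open>The coefficients of a snapshot in the retained modes are exactly the leading coefficients in its
  singular value expansion, so subtracting the projection removes precisely these terms.\<close>

lemma snapshot_residual:
  assumes svd: "is_pod_svd \<Omega> dt N u lam \<xi> \<phi>" and dt: "dt > 0"
    and u: "\<And>n. n \<in> {1..N} \<Longrightarrow> u n \<in> H10_space \<Omega>" and k: "k \<in> {1..N}"
  shows "AE x in lebesgue_on \<Omega>.
    snapshot dt u k x - (\<Sum>j=1..r. H10_inner \<Omega> (snapshot dt u k) (\<phi> j) * \<phi> j x)
      = (\<Sum>i\<in>{r+1..N}. (\<xi> i k * sqrt (lam i)) * \<phi> i x)"
proof -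
  interpret semi_inner_space "H10_space \<Omega>" "H10_inner \<Omega>" by (rule H10_inner_on_H10)
  let ?y = "snapshot dt u k" and ?c = "\<lambda>i. \<xi> i k * sqrt (lam i)"
  let ?z = "\<lambda>x. \<Sum>i=1..N. ?c i * \<phi> i x"
  have \<phi>: "\<phi> i \<in> H10_space \<Omega>" if "1 \<le> i" for i
    using svd that by (simp add: is_pod_svd_def)
  have on: "H10_inner \<Omega> (\<phi> i) (\<phi> j) = (if i = j then 1 else 0)" if "1 \<le> i" "1 \<le> j" for i j
    using svd that by (simp add: is_pod_svd_def orthonormal_on_def)
  have y: "?y \<in> H10_space \<Omega>"
    using u k by (rule snapshot_in)
  have z: "?z \<in> H10_space \<Omega>"
    using \<phi> by (intro sum_in) auto
  have "\<forall>i\<in>{1..N}. AE x in lebesgue_on \<Omega>. K1 dt N u (\<xi> i) x = sqrt (lam i) * \<phi> i x"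
    using svd by (simp add: is_pod_svd_def)
  then have "AE x in lebesgue_on \<Omega>. \<forall>i\<in>{1..N}. K1 dt N u (\<xi> i) x = sqrt (lam i) * \<phi> i x"
    by (subst AE_ball_countable) auto
  then have yz: "AE x in lebesgue_on \<Omega>. ?y x = ?z x"
  proof eventually_elim
    case (elim x)
    have "?y x = (\<Sum>i=1..N. \<xi> i k * K1 dt N u (\<xi> i) x)"
      using svd dt k by (intro snapshot_expansion) (auto simp: is_pod_svd_def)
    also have "\<dots> = ?z x"
      using elim by (intro sum.cong refl) simp
    finally show ?case .
  qed
  have grad: "weak_grad \<Omega> ?y = weak_grad \<Omega> ?z"
    using y z H10_subset_H1 H1_L2 by (intro weak_grad_cong_AE[OF _ _ yz]) auto
  have coeff: "H10_inner \<Omega> ?y (\<phi> j) = (if j \<in> {1..N} then ?c j else 0)" if j: "1 \<le> j" for j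
  proof -
    have "H10_inner \<Omega> ?y (\<phi> j) = H10_inner \<Omega> ?z (\<phi> j)"
      by (simp only: H10_inner_def grad)
    also have "\<dots> = (\<Sum>i=1..N. ?c i * H10_inner \<Omega> (\<phi> i) (\<phi> j))"
      using \<phi> j by (intro sum_left) auto
    also have "\<dots> = (\<Sum>i=1..N. if i = j then ?c i else 0)"
      using j by (intro sum.cong refl) (simp add: on)
    finally show ?thesis by (simp add: sum.delta)
  qed
  have alg: "?z x - (\<Sum>j=1..r. H10_inner \<Omega> ?y (\<phi> j) * \<phi> j x) = (\<Sum>i\<in>{r+1..N}. ?c i * \<phi> i x)" for x
  proof -
    have "(\<Sum>j=1..r. H10_inner \<Omega> ?y (\<phi> j) * \<phi> j x) = (\<Sum>j=1..r. if j \<in> {1..N} then ?c j * \<phi> j x else 0)"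
      by (intro sum.cong refl) (simp add: coeff)
    also have "\<dots> = (\<Sum>j\<in>{1..r} \<inter> {1..N}. ?c j * \<phi> j x)"
      by (rule sum.inter_restrict[symmetric]) simp
    finally have "(\<Sum>j=1..r. H10_inner \<Omega> ?y (\<phi> j) * \<phi> j x) = (\<Sum>j\<in>{1..r} \<inter> {1..N}. ?c j * \<phi> j x)" .
    moreover have "?z x = (\<Sum>j\<in>{1..r} \<inter> {1..N}. ?c j * \<phi> j x) + (\<Sum>i\<in>{r+1..N}. ?c i * \<phi> i x)"
      by (subst sum.union_disjoint[symmetric]) (auto intro!: sum.cong)
    ultimately show ?thesis by simp
  qed
  show ?thesis
    using yz
  proof eventually_elim
    case (elim x)
    show ?case unfolding elim by (rule alg)
  qed
qed

text \<open>Difference quotients and projection commute, so the difference quotients of the residuals are the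
  residuals of the snapshots.\<close>

lemma pod_projection_error:
  assumes svd: "is_pod_svd \<Omega> dt N u lam \<xi> \<phi>" and dt: "dt > 0" and N: "1 \<le> N"
    and u: "\<And>n. n \<in> {1..N} \<Longrightarrow> u n \<in> H10_space \<Omega>"
    and ip: "semi_inner_space (H10_space \<Omega>) ip"
    and ip_cong: "\<And>v w. v \<in> H10_space \<Omega> \<Longrightarrow> w \<in> H10_space \<Omega> \<Longrightarrow>
      (AE x in lebesgue_on \<Omega>. v x = w x) \<Longrightarrow> ip v v = ip w w"
    and \<eta>: "\<And>n. n \<in> {1..N} \<Longrightarrow> \<eta> n = (\<lambda>x. u n x - (\<Sum>j=1..r. H10_inner \<Omega> (u n) (\<phi> j) * \<phi> j x))"
  shows "ip (\<eta> 1) (\<eta> 1) + dt * (\<Sum>n=1..<N. ip (diff_quot dt \<eta> n) (diff_quot dt \<eta> n))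
    = (\<Sum>i=r+1..num_pos_eigenvalues N lam. lam i * ip (\<phi> i) (\<phi> i))"
proof -
  interpret H: semi_inner_space "H10_space \<Omega>" "H10_inner \<Omega>" by (rule H10_inner_on_H10)
  interpret ip: semi_inner_space "H10_space \<Omega>" ip by fact
  have \<phi>: "\<phi> i \<in> H10_space \<Omega>" if "1 \<le> i" for i
    using svd that by (simp add: is_pod_svd_def)
  have lam: "0 \<le> lam i" if "i \<in> {1..N}" for i
    using svd that by (simp add: is_pod_svd_def)
  have on: "orthonormal_on (S_inner dt N) {1..N} \<xi>"
    using svd by (simp add: is_pod_svd_def)
  have proj: "(\<lambda>x. \<Sum>j=1..r. c j * \<phi> j x) \<in> H10_space \<Omega>" for c
    using \<phi> by (intro H.sum_in) auto
  have \<eta>_in: "\<eta> n \<in> H10_space \<Omega>" if "n \<in> {1..N}" for n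
    using \<eta>[OF that] H.diff_in[OF u[OF that] proj] by simp
  have res: "snapshot dt \<eta> k = (\<lambda>x. snapshot dt u k x
      - (\<Sum>j=1..r. H10_inner \<Omega> (snapshot dt u k) (\<phi> j) * \<phi> j x))" if k: "k \<in> {1..N}" for k
  proof (cases "k = 1")
    case True
    then show ?thesis using \<eta>[OF k] by (simp add: snapshot_def)
  next
    case False
    then have k': "k - 1 \<in> {1..N}" "k - 1 + 1 = k" using k by auto
    show ?thesis
      using False \<eta>[OF k] \<eta>[OF k'(1)] H.residual_diff_quot[OF u[OF k] u[OF k'(1)] \<phi>, of r]
      by (simp add: snapshot_def diff_quot_def k'(2) del: One_nat_def)
  qed
  have sq: "ip (snapshot dt \<eta> k) (snapshot dt \<eta> k)
      = ip (\<lambda>x. \<Sum>i\<in>{r+1..N}. (\<xi> i k * sqrt (lam i)) * \<phi> i x)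
           (\<lambda>x. \<Sum>i\<in>{r+1..N}. (\<xi> i k * sqrt (lam i)) * \<phi> i x)" if k: "k \<in> {1..N}" for k
  proof (rule ip_cong)
    show "snapshot dt \<eta> k \<in> H10_space \<Omega>"
      using \<eta>_in k by (rule H.snapshot_in)
    show "(\<lambda>x. \<Sum>i\<in>{r+1..N}. (\<xi> i k * sqrt (lam i)) * \<phi> i x) \<in> H10_space \<Omega>"
      using \<phi> by (intro H.sum_in) auto
    show "AE x in lebesgue_on \<Omega>. snapshot dt \<eta> k x = (\<Sum>i\<in>{r+1..N}. (\<xi> i k * sqrt (lam i)) * \<phi> i x)"
      unfolding res[OF k] by (rule snapshot_residual[OF svd dt u k])
  qed
  have "ip (\<eta> 1) (\<eta> 1) + dt * (\<Sum>n=1..<N. ip (diff_quot dt \<eta> n) (diff_quot dt \<eta> n))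
      = (\<Sum>k=1..N. S_weight dt k * ip (snapshot dt \<eta> k) (snapshot dt \<eta> k))"
    by (rule sum_snapshot[OF N, of dt "\<lambda>k y. ip y y" \<eta>, symmetric])
  also have "\<dots> = (\<Sum>k=1..N. S_weight dt k *
      ip (\<lambda>x. \<Sum>i\<in>{r+1..N}. (\<xi> i k * sqrt (lam i)) * \<phi> i x)
         (\<lambda>x. \<Sum>i\<in>{r+1..N}. (\<xi> i k * sqrt (lam i)) * \<phi> i x))"
    by (rule sum.cong[OF refl]) (simp only: sq)
  also have "\<dots> = (\<Sum>i\<in>{r+1..N}. lam i * ip (\<phi> i) (\<phi> i))"
    by (rule ip.sum_of_snapshot_squares[OF on N]) (use \<phi> lam in auto)
  also have "\<dots> = (\<Sum>i=r+1..num_pos_eigenvalues N lam. lam i * ip (\<phi> i) (\<phi> i))"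
  proof -
    have pos: "{i \<in> {1..N}. lam i > 0} = {1..num_pos_eigenvalues N lam}"
      using svd by (intro positive_eigenvalue_indices) (auto simp: is_pod_svd_def)
    then have "{1..num_pos_eigenvalues N lam} \<subseteq> {1..N}"
      by blast
    moreover have "lam i = 0" if "i \<in> {r+1..N} - {r+1..num_pos_eigenvalues N lam}" for i
    proof -
      have "i \<in> {1..N}" and "i \<notin> {i \<in> {1..N}. lam i > 0}"
        using that unfolding pos by auto
      then show ?thesis using lam[of i] by auto
    qed
    ultimately show ?thesis
      by (intro sum.mono_neutral_right) auto
  qed
  finally show ?thesis .
qed

end

section \<open>The error of the reduced order model\<close>

context bounded_open_set
begin

text \<open>The Ritz projection is what makes \<open>\<nu> (\<nabla>\<eta>, \<nabla>v)\<close> disappear, leaving only the \<open>L\<^sup>2\<close> part of \<open>\<eta>\<close> as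
  the load.\<close>

lemma pod_error_equation:
  assumes Vh: "conforming_space \<Omega> Vh"
    and be: "backward_euler \<Omega> \<nu> T f N Vh u"
    and be_r: "backward_euler \<Omega> \<nu> T f N Vr ur"
    and Vr: "Vr \<subseteq> Vh" and R: "is_ritz_proj \<Omega> Vr R"
    and n: "n \<in> {1..<N}" and v: "v \<in> Vr"
  shows "L2_inner \<Omega> (diff_quot (time_step T N) (\<lambda>n x. ur n x - R (u n) x) n) v
      + \<nu> * H10_inner \<Omega> (\<lambda>x. ur (Suc n) x - R (u (Suc n)) x) v
    = L2_inner \<Omega> (diff_quot (time_step T N) (\<lambda>n x. u n x - R (u n) x) n) v"
proof -
  interpret m: semi_inner_space "H10_space \<Omega>" "L2_inner \<Omega>" by (rule L2_inner_on_H10)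
  interpret a: semi_inner_space "H10_space \<Omega>" "H10_inner \<Omega>" by (rule H10_inner_on_H10)
  have Vh_V: "Vh \<subseteq> H10_space \<Omega>"
    by (rule conforming_space_subset_H10[OF Vh])
  have vV: "v \<in> H10_space \<Omega>" using v Vr Vh_V by blast
  have u: "u k \<in> H10_space \<Omega>" and ur: "ur k \<in> H10_space \<Omega>" if "k \<in> {1..N}" for k
    using be be_r that Vr Vh_V unfolding backward_euler_def by blast+
  have Ru: "R (u k) \<in> H10_space \<Omega>" if "k \<in> {1..N}" for k
    using R u[OF that] Vr Vh_V unfolding is_ritz_proj_def by blast
  have n1: "n \<in> {1..N}" "Suc n \<in> {1..N}" and n': "n \<in> {1..N-1}"
    using n by auto
  have orth: "H10_inner \<Omega> (u (Suc n)) v = H10_inner \<Omega> (R (u (Suc n))) v"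
  proof -
    have "H10_inner \<Omega> (\<lambda>x. u (Suc n) x - R (u (Suc n)) x) v = 0"
      using R u[OF n1(2)] v unfolding is_ritz_proj_def H10_inner_def by blast
    then show ?thesis
      using a.diff[OF u[OF n1(2)] Ru[OF n1(2)] vV] by simp
  qed
  let ?dt = "time_step T N" and ?F = "L2_inner \<Omega> (f (time_node T N (n+1))) v"
  have dq: "L2_inner \<Omega> (\<lambda>x. (w (Suc n) x - w n x) / ?dt) v = (L2_inner \<Omega> (w (Suc n)) v - L2_inner \<Omega> (w n) v) / ?dt"
    if "\<And>k. k \<in> {1..N} \<Longrightarrow> w k \<in> H10_space \<Omega>" for w
    by (rule m.diff_quot_left[OF that[OF n1(2)] that[OF n1(1)] vV])
  have "L2_inner \<Omega> (\<lambda>x. (u (n+1) x - u n x) / ?dt) v + \<nu> * L2_inner \<Omega> (weak_grad \<Omega> (u (n+1))) (weak_grad \<Omega> v) = ?F"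
    using be n' v Vr unfolding backward_euler_def by blast
  then have eq: "(L2_inner \<Omega> (u (Suc n)) v - L2_inner \<Omega> (u n) v) / ?dt + \<nu> * H10_inner \<Omega> (u (Suc n)) v = ?F"
    by (simp only: H10_inner_def[symmetric] Suc_eq_plus1[symmetric] dq[of u, OF u])
  have "L2_inner \<Omega> (\<lambda>x. (ur (n+1) x - ur n x) / ?dt) v + \<nu> * L2_inner \<Omega> (weak_grad \<Omega> (ur (n+1))) (weak_grad \<Omega> v) = ?F"
    using be_r n' v unfolding backward_euler_def by blast
  then have eq_r: "(L2_inner \<Omega> (ur (Suc n)) v - L2_inner \<Omega> (ur n) v) / ?dt + \<nu> * H10_inner \<Omega> (ur (Suc n)) v = ?F"
    by (simp only: H10_inner_def[symmetric] Suc_eq_plus1[symmetric] dq[of ur, OF ur])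
  have res: "L2_inner \<Omega> (diff_quot ?dt (\<lambda>n x. w n x - R (u n) x) n) v
      = (L2_inner \<Omega> (w (Suc n)) v - L2_inner \<Omega> (w n) v) / ?dt
        - (L2_inner \<Omega> (R (u (Suc n))) v - L2_inner \<Omega> (R (u n)) v) / ?dt"
    if w: "\<And>k. k \<in> {1..N} \<Longrightarrow> w k \<in> H10_space \<Omega>" for w
  proof -
    have "L2_inner \<Omega> (diff_quot ?dt (\<lambda>n x. w n x - R (u n) x) n) v
        = (L2_inner \<Omega> (\<lambda>x. w (Suc n) x - R (u (Suc n)) x) v - L2_inner \<Omega> (\<lambda>x. w n x - R (u n) x) v) / ?dt"
      unfolding diff_quot_def Suc_eq_plus1[symmetric] by (intro dq m.diff_in w Ru)
    also have "\<dots> = ((L2_inner \<Omega> (w (Suc n)) v - L2_inner \<Omega> (R (u (Suc n))) v)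
        - (L2_inner \<Omega> (w n) v - L2_inner \<Omega> (R (u n)) v)) / ?dt"
      by (simp only: m.diff[OF w[OF n1(1)] Ru[OF n1(1)] vV] m.diff[OF w[OF n1(2)] Ru[OF n1(2)] vV])
    finally show ?thesis
      by (simp add: diff_divide_distrib)
  qed
  have "H10_inner \<Omega> (\<lambda>x. ur (Suc n) x - R (u (Suc n)) x) v = H10_inner \<Omega> (ur (Suc n)) v - H10_inner \<Omega> (u (Suc n)) v"
    by (simp only: a.diff[OF ur[OF n1(2)] Ru[OF n1(2)] vV] orth)
  then show ?thesis
    using eq eq_r by (simp only: res[of u, OF u] res[of ur, OF ur] right_diff_distrib)
qed

text \<open>In the \<open>H\<^sup>1\<^sub>0\<close> norm the modes are normalised, so the projection error there is \<open>\<Gamma>\<close>, while \<open>\<Lambda>\<close>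
  measures it in \<open>L\<^sup>2\<close> and also bounds the load of the error equation.\<close>

lemma pod_error_bounds:
  assumes \<nu>: "\<nu> > 0" and T: "T > 0" and N: "N \<ge> 2"
    and Vh: "conforming_space \<Omega> Vh"
    and be: "backward_euler \<Omega> \<nu> T f N Vh u"
    and svd: "is_pod_svd \<Omega> (time_step T N) N u lam \<xi> \<phi>"
    and \<phi>: "\<forall>i\<in>{1..r}. \<phi> i \<in> Vh"
    and R: "is_ritz_proj \<Omega> (pod_space \<phi> r) R"
    and be_r: "backward_euler \<Omega> \<nu> T f N (pod_space \<phi> r) ur"
    and e_def: "e = (\<lambda>k x. u k x - ur k x)" and p_def: "p = (\<lambda>k x. ur k x - R (u k) x)"
    and \<Lambda>_def: "\<Lambda> = (\<Sum>i=r+1..num_pos_eigenvalues N lam. lam i * L2_inner \<Omega> (\<phi> i) (\<phi> i))"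
    and \<Gamma>_def: "\<Gamma> = (\<Sum>i=r+1..num_pos_eigenvalues N lam. lam i)"
  shows "k \<in> {1..N} \<Longrightarrow> L2_inner \<Omega> (e k) (e k) \<le> (4 + 8 * T) * \<Lambda> + 4 * L2_inner \<Omega> (p 1) (p 1)"
    and "k \<in> {1..N} \<Longrightarrow> H10_inner \<Omega> (e k) (e k)
      \<le> (4 + 4 * T) * \<Gamma> + \<Lambda> / \<nu> + 2 * H10_inner \<Omega> (p 1) (p 1)"
    and "\<nu> * time_step T N * (\<Sum>n=1..<N. H10_inner \<Omega> (e (Suc n)) (e (Suc n)))
      \<le> \<nu> * T * (4 + 4 * T) * \<Gamma> + 3 * T * \<Lambda> + 2 * L2_inner \<Omega> (p 1) (p 1)"
    and "0 \<le> \<Lambda>" and "0 \<le> \<Gamma>"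
proof -
  interpret m: semi_inner_space "H10_space \<Omega>" "L2_inner \<Omega>" by (rule L2_inner_on_H10)
  interpret a: semi_inner_space "H10_space \<Omega>" "H10_inner \<Omega>" by (rule H10_inner_on_H10)
  let ?dt = "time_step T N" and ?V = "H10_space \<Omega>" and ?W = "pod_space \<phi> r"
  define \<eta> where "\<eta> = (\<lambda>k x. u k x - R (u k) x)"
  have dt: "?dt > 0" and dtT: "?dt * real (N - 1) = T"
    using T N by (auto simp: time_step_def)
  have N1: "1 \<le> N" using N by simp
  have Vh_V: "Vh \<subseteq> ?V" by (rule conforming_space_subset_H10[OF Vh])
  have W_Vh: "?W \<subseteq> Vh" using \<phi> by (intro pod_space_subset_conforming_space[OF Vh]) auto
  have W_V: "?W \<subseteq> ?V" using W_Vh Vh_V by blast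
  have u: "u k \<in> ?V" and ur: "ur k \<in> ?W" if "k \<in> {1..N}" for k
    using be be_r that Vh_V unfolding backward_euler_def by blast+
  have Ru: "R (u k) \<in> ?W" if "k \<in> {1..N}" for k
    using R u[OF that] unfolding is_ritz_proj_def by blast
  have p: "p k \<in> ?W" if "k \<in> {1..N}" for k
    unfolding p_def by (rule pod_space_diff[OF ur[OF that] Ru[OF that]])
  have \<eta>: "\<eta> k \<in> ?V" if "k \<in> {1..N}" for k
    unfolding \<eta>_def using Ru[OF that] W_V by (intro m.diff_in u[OF that]) auto
  have \<phi>_V: "\<phi> i \<in> ?V" if "1 \<le> i" for i
    using svd that by (simp add: is_pod_svd_def)
  have \<phi>_on: "orthonormal_on (H10_inner \<Omega>) {1..} \<phi>"
    using svd by (simp add: is_pod_svd_def)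
  have R_eq: "R (u k) = (\<lambda>x. \<Sum>j=1..r. H10_inner \<Omega> (u k) (\<phi> j) * \<phi> j x)" if k: "k \<in> {1..N}" for k
    using R u[OF k]
    by (intro a.projection_onto_pod_space[OF \<phi>_on \<phi>_V u[OF k] Ru[OF k]])
       (auto simp: is_ritz_proj_def H10_inner_def)
  have \<eta>_eq: "\<eta> k = (\<lambda>x. u k x - (\<Sum>j=1..r. H10_inner \<Omega> (u k) (\<phi> j) * \<phi> j x))" if "k \<in> {1..N}" for k
    unfolding \<eta>_def R_eq[OF that] ..
  have proj_m: "L2_inner \<Omega> (\<eta> 1) (\<eta> 1)
      + ?dt * (\<Sum>n=1..<N. L2_inner \<Omega> (diff_quot ?dt \<eta> n) (diff_quot ?dt \<eta> n)) = \<Lambda>"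
    unfolding \<Lambda>_def
  proof (rule pod_projection_error[OF svd dt N1 u L2_inner_on_H10 _ \<eta>_eq])
    show "L2_inner \<Omega> v v = L2_inner \<Omega> w w"
      if "v \<in> ?V" "w \<in> ?V" "AE x in lebesgue_on \<Omega>. v x = w x" for v w
      using that H10_subset_H1 H1_L2 by (intro L2_inner_cong_AE) auto
  qed
  have proj_a: "H10_inner \<Omega> (\<eta> 1) (\<eta> 1)
      + ?dt * (\<Sum>n=1..<N. H10_inner \<Omega> (diff_quot ?dt \<eta> n) (diff_quot ?dt \<eta> n)) = \<Gamma>"
  proof -
    have "H10_inner \<Omega> (\<eta> 1) (\<eta> 1)
        + ?dt * (\<Sum>n=1..<N. H10_inner \<Omega> (diff_quot ?dt \<eta> n) (diff_quot ?dt \<eta> n))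
        = (\<Sum>i=r+1..num_pos_eigenvalues N lam. lam i * H10_inner \<Omega> (\<phi> i) (\<phi> i))"
    proof (rule pod_projection_error[OF svd dt N1 u H10_inner_on_H10 _ \<eta>_eq])
      show "H10_inner \<Omega> v v = H10_inner \<Omega> w w"
        if "v \<in> ?V" "w \<in> ?V" "AE x in lebesgue_on \<Omega>. v x = w x" for v w
      proof -
        have "weak_grad \<Omega> v = weak_grad \<Omega> w"
          using that(1,2) H10_subset_H1 H1_L2 by (intro weak_grad_cong_AE[OF _ _ that(3)]) auto
        then show ?thesis by (simp only: H10_inner_def)
      qed
    qed
    also have "\<dots> = \<Gamma>"
      unfolding \<Gamma>_def using \<phi>_on by (intro sum.cong refl) (simp add: orthonormal_on_def)
    finally show ?thesis .
  qed
  interpret E: discrete_parabolic ?V "L2_inner \<Omega>" "H10_inner \<Omega>" ?W p "diff_quot ?dt \<eta>" \<nu> ?dt T N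
  proof
    fix n v assume "n \<in> {1..<N}" "v \<in> ?W"
    then show "L2_inner \<Omega> (diff_quot ?dt p n) v + \<nu> * H10_inner \<Omega> (p (Suc n)) v
        = L2_inner \<Omega> (diff_quot ?dt \<eta> n) v"
      unfolding p_def \<eta>_def by (rule pod_error_equation[OF Vh be be_r W_Vh R])
  next
    fix n assume "n \<in> {1..<N}"
    then show "diff_quot ?dt \<eta> n \<in> ?V"
      unfolding diff_quot_def by (intro m.diff_quot_in \<eta>) auto
  qed (fact \<nu> dt N1 dtT W_V | erule pod_space_diff p | rule p | assumption)+
  have load: "E.load_L2_sq \<le> \<Lambda>" and load0: "0 \<le> E.load_L2_sq"
    using proj_m m.nonneg[OF \<eta>[of 1]] dt N E.q
    by (auto simp: E.load_L2_sq_def intro!: mult_nonneg_nonneg sum_nonneg m.nonneg)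
  show \<Lambda>0: "0 \<le> \<Lambda>" using load load0 by linarith
  show \<Gamma>0: "0 \<le> \<Gamma>"
    unfolding proj_a[symmetric] using dt N E.q
    by (intro add_nonneg_nonneg mult_nonneg_nonneg sum_nonneg a.nonneg \<eta>) auto
  have e: "e k = (\<lambda>x. \<eta> k x - p k x)" for k
    by (simp add: e_def \<eta>_def p_def)
  have \<eta>_m: "L2_inner \<Omega> (\<eta> k) (\<eta> k) \<le> 2 * (1 + T) * \<Lambda>" if k: "k \<in> {1..N}" for k
    using m.pointwise_in_time_bound[of N \<eta>, OF \<eta> dt dtT k] unfolding proj_m .
  have \<eta>_a: "2 * H10_inner \<Omega> (\<eta> k) (\<eta> k) \<le> (4 + 4 * T) * \<Gamma>" if k: "k \<in> {1..N}" for k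
    using a.pointwise_in_time_bound[of N \<eta>, OF \<eta> dt dtT k] unfolding proj_a by (simp add: algebra_simps)
  have e_m: "L2_inner \<Omega> (e k) (e k) \<le> 2 * L2_inner \<Omega> (\<eta> k) (\<eta> k) + 2 * L2_inner \<Omega> (p k) (p k)"
    and e_a: "H10_inner \<Omega> (e k) (e k) \<le> 2 * H10_inner \<Omega> (\<eta> k) (\<eta> k) + 2 * H10_inner \<Omega> (p k) (p k)"
    if "k \<in> {1..N}" for k
    unfolding e using that m.parallelogram_le[OF \<eta> E.p_V] a.parallelogram_le[OF \<eta> E.p_V] by blast+
  have Tload: "T * E.load_L2_sq \<le> T * \<Lambda>"
    using load T by simp
  show "L2_inner \<Omega> (e k) (e k) \<le> (4 + 8 * T) * \<Lambda> + 4 * L2_inner \<Omega> (p 1) (p 1)" if k: "k \<in> {1..N}"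
    using e_m[OF k] \<eta>_m[OF k] E.m_bound[OF k] Tload by (simp add: algebra_simps)
  show "H10_inner \<Omega> (e k) (e k) \<le> (4 + 4 * T) * \<Gamma> + \<Lambda> / \<nu> + 2 * H10_inner \<Omega> (p 1) (p 1)" if k: "k \<in> {1..N}"
  proof -
    have "2 * (E.load_L2_sq / (2 * \<nu>)) \<le> \<Lambda> / \<nu>"
      using divide_right_mono[OF load, of \<nu>] \<nu> by simp
    then show ?thesis
      using e_a[OF k] \<eta>_a[OF k] E.a_bound[OF k] by linarith
  qed
  let ?S = "\<Sum>n=1..<N. H10_inner \<Omega> (p (Suc n)) (p (Suc n))"
  have "(\<Sum>n=1..<N. H10_inner \<Omega> (e (Suc n)) (e (Suc n)))
      \<le> (\<Sum>n=1..<N. (4 + 4 * T) * \<Gamma> + 2 * H10_inner \<Omega> (p (Suc n)) (p (Suc n)))"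
  proof (rule sum_mono)
    fix n assume "n \<in> {1..<N}"
    then have "Suc n \<in> {1..N}" by auto
    then show "H10_inner \<Omega> (e (Suc n)) (e (Suc n)) \<le> (4 + 4 * T) * \<Gamma> + 2 * H10_inner \<Omega> (p (Suc n)) (p (Suc n))"
      using e_a[of "Suc n"] \<eta>_a[of "Suc n"] by linarith
  qed
  also have "\<dots> = real (N - 1) * ((4 + 4 * T) * \<Gamma>) + 2 * ?S"
    by (simp add: sum.distrib sum_distrib_left)
  finally have "\<nu> * ?dt * (\<Sum>n=1..<N. H10_inner \<Omega> (e (Suc n)) (e (Suc n)))
      \<le> \<nu> * ?dt * (real (N - 1) * ((4 + 4 * T) * \<Gamma>) + 2 * ?S)"
    using \<nu> dt by (intro mult_left_mono) auto
  also have "\<dots> = \<nu> * (?dt * real (N - 1)) * (4 + 4 * T) * \<Gamma> + 2 * (\<nu> * ?dt * ?S)"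
    by (simp add: algebra_simps)
  also have "\<dots> \<le> \<nu> * T * (4 + 4 * T) * \<Gamma> + 3 * T * \<Lambda> + 2 * L2_inner \<Omega> (p 1) (p 1)"
    unfolding dtT using E.dissipation_bound Tload by simp
  finally show "\<nu> * ?dt * (\<Sum>n=1..<N. H10_inner \<Omega> (e (Suc n)) (e (Suc n)))
      \<le> \<nu> * T * (4 + 4 * T) * \<Gamma> + 3 * T * \<Lambda> + 2 * L2_inner \<Omega> (p 1) (p 1)" .
qed

end

theorem theorem4p5:
  fixes \<Omega> :: "'a::euclidean_space set" and \<nu> T :: real and f :: "real \<Rightarrow> 'a \<Rightarrow> real"
  assumes "bounded_lipschitz_domain \<Omega>"
    and "\<nu> > 0" and "T > 0"
    and "\<And>t. t \<in> {0..T} \<Longrightarrow> f t \<in> L2_space \<Omega>"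
  shows "\<exists>C>0. \<forall>Vh N u lam \<xi> \<phi> s r Vr P R ur.
      conforming_space \<Omega> Vh \<and> N \<ge> 2 \<and>
      backward_euler \<Omega> \<nu> T f N Vh u \<and>
      is_pod_svd \<Omega> (time_step T N) N u lam \<xi> \<phi> \<and>
      s = num_pos_eigenvalues N lam \<and>
      r \<ge> 1 \<and> (\<forall>i\<in>{1..r}. \<phi> i \<in> Vh) \<and> Vr = pod_space \<phi> r \<and>
      is_orth_proj (H10_inner \<Omega>) (H10_space \<Omega>) Vr P \<and>
      is_ritz_proj \<Omega> Vr R \<and>
      ur 1 = P (u 1) \<and> backward_euler \<Omega> \<nu> T f N Vr ur
    \<longrightarrow>
      (let e = (\<lambda>k x. u k x - ur k x); \<phi>r = (\<lambda>n x. ur n x - R (u n) x) in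
        Max ((\<lambda>k. (L2_norm \<Omega> (e k))\<^sup>2) ` {1..N})
          \<le> C * ((\<Sum>i=r+1..s. lam i * (L2_norm \<Omega> (\<phi> i))\<^sup>2) + (L2_norm \<Omega> (\<phi>r 1))\<^sup>2)
      \<and> Max ((\<lambda>k. (L2_norm \<Omega> (weak_grad \<Omega> (e k)))\<^sup>2) ` {1..N})
          \<le> C * ((\<Sum>i=r+1..s. lam i * ((L2_norm \<Omega> (\<phi> i))\<^sup>2 + 1)) + (H10_norm \<Omega> (\<phi>r 1))\<^sup>2)
      \<and> (L2_norm \<Omega> (e N))\<^sup>2
          + \<nu> * time_step T N * (\<Sum>n=1..N-1. (L2_norm \<Omega> (weak_grad \<Omega> (e (n+1))))\<^sup>2)
          \<le> C * ((\<Sum>i=r+1..s. lam i * (1 + (L2_norm \<Omega> (\<phi> i))\<^sup>2)) + (L2_norm \<Omega> (\<phi>r 1))\<^sup>2))"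
proof -
  interpret bounded_open_set \<Omega>
    using assms(1) by unfold_locales (auto simp: bounded_lipschitz_domain_def)
  note \<nu> = assms(2) and T = assms(3)
  \<comment> \<open>A number above each of the constants in \<open>pod_error_bounds\<close> and in the sum of two of these bounds.\<close>
  define C where "C = 10 + 15 * T + 1 / \<nu> + \<nu> * T * (4 + 4 * T)"
  have nonneg: "0 \<le> 1 / \<nu>" "0 \<le> \<nu> * T * (4 + 4 * T)" "0 \<le> T"
    using \<nu> T by simp_all
  have C: "C > 0" "4 + 8 * T \<le> C" "4 + 4 * T \<le> C" "1 / \<nu> \<le> C"
    "4 + 11 * T \<le> C" "\<nu> * T * (4 + 4 * T) \<le> C" "6 \<le> C" "4 \<le> C" "2 \<le> C"
    unfolding C_def using nonneg by linarith+
  have norm_L2: "(L2_norm \<Omega> w)\<^sup>2 = L2_inner \<Omega> w w" for w :: "'a \<Rightarrow> real"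
    by (simp add: L2_norm_def L2_inner_nonneg)
  have norm_grad: "(L2_norm \<Omega> (weak_grad \<Omega> w))\<^sup>2 = H10_inner \<Omega> w w" for w
    by (simp add: L2_norm_def H10_inner_def L2_inner_nonneg)
  have norm_H10: "(H10_norm \<Omega> w)\<^sup>2 = H10_inner \<Omega> w w" for w
    by (simp add: H10_norm_def H10_inner_def L2_inner_nonneg)
  show ?thesis
  proof (intro exI[of _ C] conjI allI impI C(1))
    fix Vh N u lam \<xi> \<phi> s r Vr P R ur
    assume H: "conforming_space \<Omega> Vh \<and> N \<ge> 2 \<and>
      backward_euler \<Omega> \<nu> T f N Vh u \<and>
      is_pod_svd \<Omega> (time_step T N) N u lam \<xi> \<phi> \<and>
      s = num_pos_eigenvalues N lam \<and>
      r \<ge> 1 \<and> (\<forall>i\<in>{1..r}. \<phi> i \<in> Vh) \<and> Vr = pod_space \<phi> r \<and>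
      is_orth_proj (H10_inner \<Omega>) (H10_space \<Omega>) Vr P \<and>
      is_ritz_proj \<Omega> Vr R \<and>
      ur 1 = P (u 1) \<and> backward_euler \<Omega> \<nu> T f N Vr ur"
    define e where "e = (\<lambda>k x. u k x - ur k x)"
    define p where "p = (\<lambda>k x. ur k x - R (u k) x)"
    define \<Lambda> where "\<Lambda> = (\<Sum>i=r+1..num_pos_eigenvalues N lam. lam i * L2_inner \<Omega> (\<phi> i) (\<phi> i))"
    define \<Gamma> where "\<Gamma> = (\<Sum>i=r+1..num_pos_eigenvalues N lam. lam i)"
    have N: "N \<ge> 2" and s: "s = num_pos_eigenvalues N lam" using H by auto
    have bounds: "\<And>k. k \<in> {1..N} \<Longrightarrow> L2_inner \<Omega> (e k) (e k) \<le> (4 + 8 * T) * \<Lambda> + 4 * L2_inner \<Omega> (p 1) (p 1)"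
      "\<And>k. k \<in> {1..N} \<Longrightarrow> H10_inner \<Omega> (e k) (e k)
        \<le> (4 + 4 * T) * \<Gamma> + \<Lambda> / \<nu> + 2 * H10_inner \<Omega> (p 1) (p 1)"
      "\<nu> * time_step T N * (\<Sum>n=1..<N. H10_inner \<Omega> (e (Suc n)) (e (Suc n)))
        \<le> \<nu> * T * (4 + 4 * T) * \<Gamma> + 3 * T * \<Lambda> + 2 * L2_inner \<Omega> (p 1) (p 1)"
      and \<Lambda>0: "0 \<le> \<Lambda>" and \<Gamma>0: "0 \<le> \<Gamma>"
      using H by (intro pod_error_bounds[OF \<nu> T _ _ _ _ _ _ _ e_def p_def \<Lambda>_def \<Gamma>_def]; blast)+
    have p0: "0 \<le> L2_inner \<Omega> (p 1) (p 1)" "0 \<le> H10_inner \<Omega> (p 1) (p 1)"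
      by (simp_all add: L2_inner_nonneg H10_inner_def)
    have le: "x * y \<le> C * y" if "x \<le> C" "0 \<le> y" for x y
      using that by (rule mult_right_mono)
    have sums: "(\<Sum>i=r+1..s. lam i * L2_inner \<Omega> (\<phi> i) (\<phi> i)) = \<Lambda>"
      "(\<Sum>i=r+1..s. lam i * (L2_inner \<Omega> (\<phi> i) (\<phi> i) + 1)) = \<Lambda> + \<Gamma>"
      "(\<Sum>i=r+1..s. lam i * (1 + L2_inner \<Omega> (\<phi> i) (\<phi> i))) = \<Lambda> + \<Gamma>"
      by (simp_all add: \<Lambda>_def \<Gamma>_def s distrib_left sum.distrib)
    have ne: "(g ` {1..N}) \<noteq> {}" for g :: "nat \<Rightarrow> real"
      using N by simp
    have 1: "L2_inner \<Omega> (e k) (e k) \<le> C * (\<Lambda> + L2_inner \<Omega> (p 1) (p 1))" if "k \<in> {1..N}" for k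
      using bounds(1)[OF that] le[OF C(2) \<Lambda>0] le[OF C(8) p0(1)] unfolding distrib_left by linarith
    have 2: "H10_inner \<Omega> (e k) (e k) \<le> C * (\<Lambda> + \<Gamma> + H10_inner \<Omega> (p 1) (p 1))" if "k \<in> {1..N}" for k
      using bounds(2)[OF that] le[OF C(3) \<Gamma>0] le[OF C(4) \<Lambda>0] le[OF C(9) p0(2)]
      unfolding distrib_left by simp
    have 3: "L2_inner \<Omega> (e N) (e N)
        + \<nu> * time_step T N * (\<Sum>n=1..<N. H10_inner \<Omega> (e (Suc n)) (e (Suc n)))
        \<le> C * (\<Lambda> + \<Gamma> + L2_inner \<Omega> (p 1) (p 1))"
    proof -
      have "L2_inner \<Omega> (e N) (e N)
          + \<nu> * time_step T N * (\<Sum>n=1..<N. H10_inner \<Omega> (e (Suc n)) (e (Suc n)))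
          \<le> (4 + 11 * T) * \<Lambda> + \<nu> * T * (4 + 4 * T) * \<Gamma> + 6 * L2_inner \<Omega> (p 1) (p 1)"
        using bounds(1)[of N] bounds(3) N by (simp add: algebra_simps)
      then show ?thesis
        using le[OF C(5) \<Lambda>0] le[OF C(6) \<Gamma>0] le[OF C(7) p0(1)] unfolding distrib_left by linarith
    qed
    have range: "{1..N-1} = {1..<N}" using N by auto
    have "Max ((\<lambda>k. L2_inner \<Omega> (e k) (e k)) ` {1..N}) \<le> C * (\<Lambda> + L2_inner \<Omega> (p 1) (p 1))"
      using 1 ne by (subst Max_le_iff) auto
    moreover have "Max ((\<lambda>k. H10_inner \<Omega> (e k) (e k)) ` {1..N}) \<le> C * (\<Lambda> + \<Gamma> + H10_inner \<Omega> (p 1) (p 1))"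
      using 2 ne by (subst Max_le_iff) auto
    ultimately show "let e = (\<lambda>k x. u k x - ur k x); \<phi>r = (\<lambda>n x. ur n x - R (u n) x) in
        Max ((\<lambda>k. (L2_norm \<Omega> (e k))\<^sup>2) ` {1..N})
          \<le> C * ((\<Sum>i=r+1..s. lam i * (L2_norm \<Omega> (\<phi> i))\<^sup>2) + (L2_norm \<Omega> (\<phi>r 1))\<^sup>2)
      \<and> Max ((\<lambda>k. (L2_norm \<Omega> (weak_grad \<Omega> (e k)))\<^sup>2) ` {1..N})
          \<le> C * ((\<Sum>i=r+1..s. lam i * ((L2_norm \<Omega> (\<phi> i))\<^sup>2 + 1)) + (H10_norm \<Omega> (\<phi>r 1))\<^sup>2)
      \<and> (L2_norm \<Omega> (e N))\<^sup>2
          + \<nu> * time_step T N * (\<Sum>n=1..N-1. (L2_norm \<Omega> (weak_grad \<Omega> (e (n+1))))\<^sup>2)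
          \<le> C * ((\<Sum>i=r+1..s. lam i * (1 + (L2_norm \<Omega> (\<phi> i))\<^sup>2)) + (L2_norm \<Omega> (\<phi>r 1))\<^sup>2)"
      unfolding Let_def e_def[symmetric] p_def[symmetric] range norm_L2 norm_grad norm_H10 sums
      using 3 by simp
  qed
qed

end
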